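(* Let $(X,d,\alpha)$ be a computable metric space which is locally computable. Let $S$ be a co-computably enumerable closed set in this space such that $S$, as a subspace of $(X,d)$, is a compact manifold with boundary. If $\partial S$ is a computable closed set, then $S$ is a computable closed set.
   Context: A computable metric space is a triple $(X,d,\alpha)$ where $(X,d)$ is a metric space and $\alpha=(\alpha_i)_{i\in\mathbb N}$ is a sequence with dense range in $(X,d)$ such that $(i,j)\mapsto d(\alpha_i,\alpha_j)$ is a computable function $\mathbb N^2\to\mathbb R$ (a function $g:\mathbb N^k\to\mathbb R$ is computable if there is a computable $G:\mathbb N^{k+1}\to\mathbb Q$ with $|g(x)-G(x,i)|<2^{-i}$ for all $x,i$). Fix a computable $q:\mathbb N\to\mathbb Q$ whose image is the set of positive rationals and computable $\tau_1,\tau_2:\mathbb N\to\mathbb N$ with $\{(\tau_1(i),\tau_2(i)):i\in\mathbb N\}=\mathbb N^2$; let $\lambda_i=\alpha_{\tau_1(i)}$, $\rho_i=q_{\tau_2(i)}$, $I_i=B(\lambda_i,\rho_i)$ (open ball). Fix computable $\sigma:\mathbb N^2\to\mathbb N$, $\eta:\mathbb N\to\mathbb N$ such that $\{(\sigma(j,0),\dots,\sigma(j,\eta(j))):j\in\mathbb N\}$ is the set of all nonempty finite sequences in $\mathbb N$; let $[j]=\{\sigma(j,i):0\le i\le\eta(j)\}$ and $J_j=\bigcup_{i\in[j]}I_i$. A closed set $S\subseteq X$ is computably enumerable (c.e.) closed if $\{i: S\cap I_i\ne\emptyset\}$ is c.e.; it is co-computably enumerable (co-c.e.) closed if there is a computable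 $f:\mathbb N\to\mathbb N$ with $X\setminus S=\bigcup_{i\in\mathbb N}I_{f(i)}$; it is a computable closed set if it is both c.e. closed and co-c.e. closed. A compact $K\subseteq X$ is a computable compact set if $\{j: K\subseteq J_j\}$ and $\{i: K\cap I_i\neq\emptyset\}$ are both c.e. The space $(X,d,\alpha)$ is locally computable if every compact set in $(X,d)$ is contained in some computable compact set. A nonempty topological space $M$ is an $n$-manifold with boundary ($n\ge1$) if each point has a neighborhood homeomorphic to an open subset of $\mathbb H^n=\{(x_1,\dots,x_n)\in\mathbb R^n: x_n\ge0\}$; its boundary $\partial M$ is the set of points $x$ for which some homeomorphism from a neighborhood of $x$ onto an open subset of $\mathbb H^n$ sends $x$ into $\{x_n=0\}$. *)

theory Defs
  imports "HOL-Analysis.Analysis" "HOL-Library.Nat_Bijection"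
begin

datatype recf = Z | Sc | Proj nat | Comp recf "recf list" | Prim recf recf | Mu recf

inductive reval :: "recf \<Rightarrow> nat list \<Rightarrow> nat \<Rightarrow> bool" where
  reval_Z: "reval Z xs 0"
| reval_Sc: "reval Sc (x # xs) (Suc x)"
| reval_Proj: "i < length xs \<Longrightarrow> reval (Proj i) xs (xs ! i)"
| reval_Comp: "list_all2 (\<lambda>g y. reval g xs y) gs ys \<Longrightarrow> reval f ys y \<Longrightarrow> reval (Comp f gs) xs y"
| reval_Prim0: "reval f xs y \<Longrightarrow> reval (Prim f g) (0 # xs) y"
| reval_PrimS: "reval (Prim f g) (n # xs) y \<Longrightarrow> reval g (y # n # xs) z \<Longrightarrow>
                reval (Prim f g) (Suc n # xs) z"
| reval_Mu: "reval f (n # xs) 0 \<Longrightarrow> (\<forall>m<n. \<exists>k. reval f (m # xs) (Suc k)) \<Longrightarrow>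
             reval (Mu f) xs n"

definition computable1 :: "(nat \<Rightarrow> nat) \<Rightarrow> bool" where
  "computable1 f \<longleftrightarrow> (\<exists>c. \<forall>x. reval c [x] (f x))"

definition computable2 :: "(nat \<Rightarrow> nat \<Rightarrow> nat) \<Rightarrow> bool" where
  "computable2 f \<longleftrightarrow> computable1 (\<lambda>n. case prod_decode n of (a, b) \<Rightarrow> f a b)"

definition ce_set :: "nat set \<Rightarrow> bool" where
  "ce_set A \<longleftrightarrow> (\<exists>c. \<forall>x. x \<in> A \<longleftrightarrow> (\<exists>y. reval c [x] y))"

definition rat_of_code :: "nat \<Rightarrow> rat" where
  "rat_of_code n = (case prod_decode n of (a, b) \<Rightarrow> of_int (int_decode a) / of_nat (Suc b))"

definition computable_rat1 :: "(nat \<Rightarrow> rat) \<Rightarrow> bool" where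
  "computable_rat1 f \<longleftrightarrow> (\<exists>h. computable1 h \<and> (\<forall>n. f n = rat_of_code (h n)))"

definition computable_rat3 :: "(nat \<Rightarrow> nat \<Rightarrow> nat \<Rightarrow> rat) \<Rightarrow> bool" where
  "computable_rat3 G \<longleftrightarrow> computable_rat1
     (\<lambda>n. case prod_decode n of (i, p) \<Rightarrow> (case prod_decode p of (j, k) \<Rightarrow> G i j k))"

definition computable_real2 :: "(nat \<Rightarrow> nat \<Rightarrow> real) \<Rightarrow> bool" where
  "computable_real2 g \<longleftrightarrow> (\<exists>G. computable_rat3 G \<and>
     (\<forall>x y i. \<bar>g x y - real_of_rat (G x y i)\<bar> < 1 / 2 ^ i))"

definition computable_metric_space :: "(nat \<Rightarrow> 'a::metric_space) \<Rightarrow> bool" where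
  "computable_metric_space \<alpha> \<longleftrightarrow> closure (range \<alpha>) = UNIV \<and>
     computable_real2 (\<lambda>i j. dist (\<alpha> i) (\<alpha> j))"

definition enum_data :: "(nat \<Rightarrow> rat) \<Rightarrow> (nat \<Rightarrow> nat) \<Rightarrow> (nat \<Rightarrow> nat) \<Rightarrow>
    (nat \<Rightarrow> nat \<Rightarrow> nat) \<Rightarrow> (nat \<Rightarrow> nat) \<Rightarrow> bool" where
  "enum_data q \<tau>1 \<tau>2 \<sigma> \<eta> \<longleftrightarrow>
     computable_rat1 q \<and> range q = {r. r > 0} \<and>
     computable1 \<tau>1 \<and> computable1 \<tau>2 \<and> range (\<lambda>i. (\<tau>1 i, \<tau>2 i)) = UNIV \<and>
     computable2 \<sigma> \<and> computable1 \<eta> \<and>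
     range (\<lambda>j. map (\<sigma> j) [0..<Suc (\<eta> j)]) = {xs. xs \<noteq> []}"

definition ballI :: "(nat \<Rightarrow> 'a::metric_space) \<Rightarrow> (nat \<Rightarrow> rat) \<Rightarrow> (nat \<Rightarrow> nat) \<Rightarrow> (nat \<Rightarrow> nat)
    \<Rightarrow> nat \<Rightarrow> 'a set" where
  "ballI \<alpha> q \<tau>1 \<tau>2 i = ball (\<alpha> (\<tau>1 i)) (real_of_rat (q (\<tau>2 i)))"

definition unionJ :: "(nat \<Rightarrow> 'a::metric_space) \<Rightarrow> (nat \<Rightarrow> rat) \<Rightarrow> (nat \<Rightarrow> nat) \<Rightarrow> (nat \<Rightarrow> nat)
    \<Rightarrow> (nat \<Rightarrow> nat \<Rightarrow> nat) \<Rightarrow> (nat \<Rightarrow> nat) \<Rightarrow> nat \<Rightarrow> 'a set" where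
  "unionJ \<alpha> q \<tau>1 \<tau>2 \<sigma> \<eta> j = (\<Union>i\<in>{\<sigma> j k | k. k \<le> \<eta> j}. ballI \<alpha> q \<tau>1 \<tau>2 i)"

definition ce_closed :: "(nat \<Rightarrow> 'a::metric_space) \<Rightarrow> (nat \<Rightarrow> rat) \<Rightarrow> (nat \<Rightarrow> nat) \<Rightarrow> (nat \<Rightarrow> nat)
    \<Rightarrow> 'a set \<Rightarrow> bool" where
  "ce_closed \<alpha> q \<tau>1 \<tau>2 S \<longleftrightarrow> closed S \<and> ce_set {i. S \<inter> ballI \<alpha> q \<tau>1 \<tau>2 i \<noteq> {}}"

definition coce_closed :: "(nat \<Rightarrow> 'a::metric_space) \<Rightarrow> (nat \<Rightarrow> rat) \<Rightarrow> (nat \<Rightarrow> nat) \<Rightarrow> (nat \<Rightarrow> nat)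
    \<Rightarrow> 'a set \<Rightarrow> bool" where
  "coce_closed \<alpha> q \<tau>1 \<tau>2 S \<longleftrightarrow> closed S \<and>
     (\<exists>f. computable1 f \<and> - S = (\<Union>i. ballI \<alpha> q \<tau>1 \<tau>2 (f i)))"

definition computable_closed :: "(nat \<Rightarrow> 'a::metric_space) \<Rightarrow> (nat \<Rightarrow> rat) \<Rightarrow> (nat \<Rightarrow> nat)
    \<Rightarrow> (nat \<Rightarrow> nat) \<Rightarrow> 'a set \<Rightarrow> bool" where
  "computable_closed \<alpha> q \<tau>1 \<tau>2 S \<longleftrightarrow> ce_closed \<alpha> q \<tau>1 \<tau>2 S \<and> coce_closed \<alpha> q \<tau>1 \<tau>2 S"

definition computable_compact :: "(nat \<Rightarrow> 'a::metric_space) \<Rightarrow> (nat \<Rightarrow> rat) \<Rightarrow> (nat \<Rightarrow> nat)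
    \<Rightarrow> (nat \<Rightarrow> nat) \<Rightarrow> (nat \<Rightarrow> nat \<Rightarrow> nat) \<Rightarrow> (nat \<Rightarrow> nat) \<Rightarrow> 'a set \<Rightarrow> bool" where
  "computable_compact \<alpha> q \<tau>1 \<tau>2 \<sigma> \<eta> K \<longleftrightarrow> compact K \<and>
     ce_set {j. K \<subseteq> unionJ \<alpha> q \<tau>1 \<tau>2 \<sigma> \<eta> j} \<and>
     ce_set {i. K \<inter> ballI \<alpha> q \<tau>1 \<tau>2 i \<noteq> {}}"

definition locally_computable :: "(nat \<Rightarrow> 'a::metric_space) \<Rightarrow> (nat \<Rightarrow> rat) \<Rightarrow> (nat \<Rightarrow> nat)
    \<Rightarrow> (nat \<Rightarrow> nat) \<Rightarrow> (nat \<Rightarrow> nat \<Rightarrow> nat) \<Rightarrow> (nat \<Rightarrow> nat) \<Rightarrow> bool" where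
  "locally_computable \<alpha> q \<tau>1 \<tau>2 \<sigma> \<eta> \<longleftrightarrow>
     (\<forall>K. compact K \<longrightarrow> (\<exists>L. K \<subseteq> L \<and> computable_compact \<alpha> q \<tau>1 \<tau>2 \<sigma> \<eta> L))"

text \<open>Closed half-space H^n, coordinates indexed 0..n-1; the last coordinate is n-1.\<close>
definition halfspace :: "nat \<Rightarrow> (nat \<Rightarrow> real) topology" where
  "halfspace n = subtopology (Euclidean_space n) {x. x (n - 1) \<ge> 0}"

definition manifold_with_boundary :: "nat \<Rightarrow> 'b topology \<Rightarrow> bool" where
  "manifold_with_boundary n M \<longleftrightarrow> n \<ge> 1 \<and> topspace M \<noteq> {} \<and>
     (\<forall>x\<in>topspace M. \<exists>U V f. openin M U \<and> x \<in> U \<and> openin (halfspace n) V \<and>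
        homeomorphic_map (subtopology M U) (subtopology (halfspace n) V) f)"

definition manifold_boundary :: "nat \<Rightarrow> 'b topology \<Rightarrow> 'b set" where
  "manifold_boundary n M = {x \<in> topspace M. \<exists>U V f. openin M U \<and> x \<in> U \<and>
     openin (halfspace n) V \<and>
     homeomorphic_map (subtopology M U) (subtopology (halfspace n) V) f \<and> f x (n - 1) = 0}"

end

(* Near a point x of S choose a chart onto a box in the half-space. If the ball I_i meets S near x at
   a point p off the boundary, then S is covered by I_i, a fixed set P away from x, and, for each
   coordinate k, two disjoint compact pieces where the k-th coordinate is above resp. below that of
   p; the boundary of S is covered by P and the lower piece of the last coordinate. Finite covers of
   the pieces by small balls that are pairwise formally disjoint and formally disjoint from fixed
   covers of the opposite faces can be found by search, because S and its boundary are co-c.e. sets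
   inside a computable compact set, so that inclusion in a finite union of balls is semidecidable
   for both. Conversely, if I_i misses S then such covers cannot exist: they would cover a cube by n
   pairs of disjoint open sets, one set of each pair avoiding each of two opposite faces, which
   Kuhn's combinatorial lemma forbids. In the last coordinate the boundary of S takes the place of
   the lower face; by invariance of domain it is locally given by the vanishing of the last
   coordinate. By compactness finitely many of these local searches enumerate all i with I_i
   meeting S. *)
theory Submission
  imports Defs "HOL-Homology.Homology"
begin

text \<open>The charts are not computable, so the search must not mention them. They enter only
  through finite sets of ball indices: a cover of the part of S away from x and covers of opposite
  faces of a box. A finite set can be built into an algorithm whatever its origin; the enumeration
  obtained is therefore not uniform in S. These indices must not depend on i, which is why
  everything is cut out by three concentric boxes of half-widths \<delta>, 2 \<delta>, 3 \<delta>,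
  fixed in advance: the gaps between them turn the required disjointness into positive distances.

  Disjointness of two balls cannot in general be confirmed by a search, but a strict inequality
  between the distance of the centres and the sum of the radii can. This is the reason for formal
  disjointness, and for covers by balls that are small compared with the distances of the compact
  pieces.

  The n pairs arise from a small box around p inside the ball: a point outside it differs from p by
  a definite amount in some coordinate, so the pairs leave only a hole that the ball fills. If the
  ball misses S there is no hole, and the pairs alone would cover the cube.\<close>

section \<open>Step-bounded evaluation of recursive functions\<close>

text \<open>The bound \<open>t\<close> limits unbounded search only; 0 means "no value found", \<open>Suc y\<close> means "value \<open>y\<close>".
  For each fixed code this is a computable function of \<open>t\<close> and the arguments, so no universal
  function is needed to dovetail computations. The loop for \<open>Mu\<close> carries the state 0 (some value
  was undefined), 1 (still searching) or \<open>n + 2\<close> (zero found at \<open>n\<close>).\<close>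
primrec ev :: "recf \<Rightarrow> nat \<Rightarrow> nat list \<Rightarrow> nat" where
  "ev Z = (\<lambda>t xs. 1)"
| "ev Sc = (\<lambda>t xs. case xs of [] \<Rightarrow> 0 | x # ys \<Rightarrow> x + 2)"
| "ev (Proj i) = (\<lambda>t xs. if i < length xs then Suc (xs ! i) else 0)"
| "ev (Comp f gs) = (\<lambda>t xs. if 0 \<in> set (map (\<lambda>e. e t xs) (map ev gs)) then 0
     else ev f t (map (\<lambda>e. e t xs - 1) (map ev gs)))"
| "ev (Prim f g) = (\<lambda>t xs. case xs of [] \<Rightarrow> 0
     | n # ys \<Rightarrow> rec_nat (ev f t ys) (\<lambda>m r. if r = 0 then 0 else ev g t ((r - 1) # m # ys)) n)"
| "ev (Mu f) = (\<lambda>t xs. rec_nat 1 (\<lambda>m r. if r = 1 then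
     (if ev f t (m # xs) = 0 then 0 else if ev f t (m # xs) = 1 then m + 2 else 1) else r) t - 1)"

text \<open>Results are shifted by one as in \<open>ev\<close>: \<open>h m = 0\<close> means
  undefined, 1 is the value zero, and at least 2 is a positive value. Once the loop has left state 1
  its state never changes again, so the final state tells what was seen on the way.\<close>

lemma ev_Mu_state:
  fixes h :: "nat \<Rightarrow> nat"
  defines "st \<equiv> rec_nat 1 (\<lambda>m r. if r = 1 then (if h m = 0 then 0 else if h m = 1 then m + 2 else 1) else r)"
  shows "(st b = 1 \<longrightarrow> (\<forall>m<b. h m \<ge> 2)) \<and>
    (\<forall>n. st b = n + 2 \<longrightarrow> n < b \<and> h n = 1 \<and> (\<forall>m<n. h m \<ge> 2))"
  unfolding st_def by (induction b) (auto simp: less_Suc_eq)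

lemma ev_Mu_state_eq:
  fixes h :: "nat \<Rightarrow> nat"
  assumes "h n = 1" "\<forall>m<n. h m \<ge> 2"
  shows "rec_nat 1 (\<lambda>m r. if r = 1 then (if h m = 0 then 0 else if h m = 1 then m + 2 else 1) else r) b
    = (if b \<le> n then 1 else n + 2)"
proof (induction b)
  case (Suc b)
  have "b < n \<Longrightarrow> h b \<noteq> 0 \<and> h b \<noteq> 1" using assms(2) by force
  then show ?case using Suc assms(1) by (cases b n rule: linorder_cases) simp_all
qed simp

lemma ev_sound: "ev c t xs = Suc y \<Longrightarrow> reval c xs y"
proof (induction c arbitrary: xs y)
  case Z then show ?case by (simp add: reval_Z)
next
  case Sc then show ?case by (auto split: list.splits intro: reval_Sc)
next
  case (Proj i) then show ?case by (auto split: if_splits intro: reval_Proj)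
next
  case (Comp f gs)
  let ?ys = "map (\<lambda>g. ev g t xs - 1) gs"
  have nz: "\<forall>g\<in>set gs. ev g t xs \<noteq> 0" and e: "ev f t ?ys = Suc y"
    using Comp.prems by (auto simp: comp_def split: if_splits)
  have "reval g xs (ev g t xs - 1)" if "g \<in> set gs" for g
    using Comp.IH(2)[OF that] nz that by (metis Suc_pred' bot_nat_0.not_eq_extremum)
  then have "list_all2 (\<lambda>g y. reval g xs y) gs ?ys"
    by (simp add: list_all2_conv_all_nth)
  then show ?case using Comp.IH(1)[OF e] by (rule reval_Comp)
next
  case (Prim f g)
  obtain n ys where xs: "xs = n # ys" using Prim.prems by (auto split: list.splits)
  let ?r = "rec_nat (ev f t ys) (\<lambda>m r. if r = 0 then 0 else ev g t ((r - 1) # m # ys))"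
  have "?r n = Suc y \<Longrightarrow> reval (Prim f g) (n # ys) y" for n y
  proof (induction n arbitrary: y)
    case 0 then show ?case using Prim.IH(1) by (auto intro: reval_Prim0)
  next
    case (Suc n)
    then obtain z where z: "?r n = Suc z" by (cases "?r n") auto
    show ?case
      by (rule reval_PrimS[OF Suc.IH[OF z]], rule Prim.IH(2)) (use Suc.prems z in simp)
  qed
  then show ?case using Prim.prems xs by simp
next
  case (Mu f)
  let ?h = "\<lambda>m. ev f t (m # xs)"
  have "rec_nat 1 (\<lambda>m r. if r = 1 then (if ?h m = 0 then 0 else if ?h m = 1 then m + 2 else 1) else r) t
     = y + 2"
    using Mu.prems by simp
  then have n: "?h y = 1" "\<forall>m<y. ?h m \<ge> 2"
    using conjunct2[OF ev_Mu_state[of ?h t]] by blast+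
  have "\<exists>k. reval f (m # xs) (Suc k)" if "m < y" for m
  proof -
    have "?h m \<ge> 2" using n(2) that by blast
    then have "?h m = Suc (Suc (?h m - 2))" by simp
    then show ?thesis by (intro exI) (rule Mu.IH)
  qed
  moreover have "reval f (y # xs) 0" using n(1) by (intro Mu.IH) simp
  ultimately show ?case by (intro reval_Mu allI impI)
qed

text \<open>With "eventually" in place of "for some bound", finitely many subcomputations succeed at
  a common bound without a separate monotonicity argument for \<open>ev\<close>.\<close>

lemma ev_complete: "reval c xs y \<Longrightarrow> \<forall>\<^sub>F t in sequentially. ev c t xs = Suc y"
proof (induction rule: reval.induct)
  case (reval_Comp xs gs ys f y)
  have len: "length gs = length ys"
    and *: "\<And>i. i < length gs \<Longrightarrow> \<forall>\<^sub>F t in sequentially. ev (gs ! i) t xs = Suc (ys ! i)"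
    using reval_Comp.IH(1) by (auto simp: list_all2_conv_all_nth)
  have "\<forall>\<^sub>F t in sequentially. \<forall>i\<in>{..<length gs}. ev (gs ! i) t xs = Suc (ys ! i)"
    by (rule eventually_ball_finite) (use * in auto)
  then show ?case using reval_Comp.IH(2)
  proof eventually_elim
    case (elim t)
    have 1: "map (\<lambda>g. ev g t xs - 1) gs = ys"
      using elim(1) len by (intro nth_equalityI) auto
    have "0 \<notin> set (map (\<lambda>g. ev g t xs) gs)"
      using elim(1) by (auto simp: in_set_conv_nth)
    then show ?case using elim(2) 1 by (simp add: comp_def)
  qed
next
  case (reval_PrimS f g n xs y z)
  from reval_PrimS.IH show ?case by eventually_elim simp
next
  case (reval_Mu f n xs)
  have "\<forall>\<^sub>F t in sequentially. \<forall>m\<in>{..<n}. ev f t (m # xs) \<ge> 2"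
  proof (rule eventually_ball_finite)
    show "\<forall>m\<in>{..<n}. \<forall>\<^sub>F t in sequentially. ev f t (m # xs) \<ge> 2"
    proof
      fix m assume "m \<in> {..<n}"
      then obtain k where "\<forall>\<^sub>F t in sequentially. ev f t (m # xs) = Suc (Suc k)"
        using reval_Mu.IH(2) by auto
      then show "\<forall>\<^sub>F t in sequentially. ev f t (m # xs) \<ge> 2" by eventually_elim simp
    qed
  qed simp
  \<comment> \<open>The loop makes \<open>t\<close> rounds, so it examines the argument
    \<open>n\<close> only if \<open>t > n\<close>.\<close>
  then show ?case using reval_Mu.IH(1) eventually_gt_at_top[of n]
  proof eventually_elim
    case (elim t)
    then show ?case using ev_Mu_state_eq[of "\<lambda>m. ev f t (m # xs)" n t] by simp
  qed
qed (auto simp: eventually_mono)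

section \<open>Total functions computed by a code at fixed arity, and their closure
  properties\<close>

definition recn :: "nat \<Rightarrow> (nat list \<Rightarrow> nat) \<Rightarrow> bool" where
  "recn k F \<longleftrightarrow> (\<exists>c. \<forall>xs. length xs = k \<longrightarrow> reval c xs (F xs))"

lemma recn_cong: "recn k F \<Longrightarrow> (\<And>xs. length xs = k \<Longrightarrow> F xs = G xs) \<Longrightarrow> recn k G"
  unfolding recn_def by force

lemma recn_zero: "recn k (\<lambda>xs. 0)"
  unfolding recn_def by (blast intro: reval_Z)

lemma recn_nth: "i < k \<Longrightarrow> recn k (\<lambda>xs. xs ! i)"
  unfolding recn_def by (blast intro: reval_Proj)

lemma recn_compose:
  assumes "recn m F" "length Gs = m" "\<forall>G\<in>set Gs. recn k G"
  shows "recn k (\<lambda>xs. F (map (\<lambda>G. G xs) Gs))"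
proof -
  obtain c where c: "\<forall>xs. length xs = m \<longrightarrow> reval c xs (F xs)" using assms(1) unfolding recn_def by blast
  obtain d where d: "\<And>G. G \<in> set Gs \<Longrightarrow> \<forall>xs. length xs = k \<longrightarrow> reval (d G) xs (G xs)"
    using assms(3) unfolding recn_def by metis
  have "reval (Comp c (map d Gs)) xs (F (map (\<lambda>G. G xs) Gs))" if "length xs = k" for xs
  proof (rule reval_Comp)
    show "list_all2 (\<lambda>g y. reval g xs y) (map d Gs) (map (\<lambda>G. G xs) Gs)"
      using d that by (simp add: list_all2_conv_all_nth)
  qed (use c assms(2) in simp)
  then show ?thesis unfolding recn_def by blast
qed

lemma recn_compose1: "recn 1 (\<lambda>ys. f (ys ! 0)) \<Longrightarrow> recn k G \<Longrightarrow> recn k (\<lambda>xs. f (G xs))"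
  using recn_compose[of 1 "\<lambda>ys. f (ys ! 0)" "[G]" k] by simp

lemma recn_compose2:
  "recn 2 (\<lambda>ys. f (ys ! 0) (ys ! 1)) \<Longrightarrow> recn k G \<Longrightarrow> recn k H \<Longrightarrow> recn k (\<lambda>xs. f (G xs) (H xs))"
  using recn_compose[of 2 "\<lambda>ys. f (ys ! 0) (ys ! 1)" "[G, H]" k] by simp

lemma recn_Suc: "recn k F \<Longrightarrow> recn k (\<lambda>xs. Suc (F xs))"
proof (rule recn_compose1[of Suc])
  show "recn 1 (\<lambda>ys. Suc (ys ! 0))"
    unfolding recn_def
  proof (intro exI[of _ Sc] allI impI)
    fix xs :: "nat list" assume "length xs = 1"
    then obtain x where "xs = [x]" by (auto simp: length_Suc_conv)
    then show "reval Sc xs (Suc (xs ! 0))" by (simp add: reval_Sc)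
  qed
qed

lemma recn_const: "recn k (\<lambda>xs. a)"
  by (induction a) (auto intro: recn_zero recn_Suc)

lemma recn_rec_nat:
  assumes F: "recn k F" and G: "recn (Suc (Suc k)) (\<lambda>l. G (l ! 0) (l ! 1) (drop 2 l))" and N: "recn k N"
  shows "recn k (\<lambda>xs. rec_nat (F xs) (\<lambda>m r. G r m xs) (N xs))"
proof -
  obtain c where c: "\<forall>xs. length xs = k \<longrightarrow> reval c xs (F xs)" using F unfolding recn_def by blast
  obtain d where d: "\<forall>xs. length xs = Suc (Suc k) \<longrightarrow> reval d xs (G (xs ! 0) (xs ! 1) (drop 2 xs))"
    using G unfolding recn_def by blast
  have "reval (Prim c d) (n # xs) (rec_nat (F xs) (\<lambda>m r. G r m xs) n)" if "length xs = k" for n xs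
  proof (induction n)
    case 0 show ?case using c that by (simp add: reval_Prim0)
  next
    case (Suc n) show ?case
      using reval_PrimS[OF Suc d[rule_format]] that by simp
  qed
  then have "reval (Prim c d) xs (rec_nat (F (tl xs)) (\<lambda>m r. G r m (tl xs)) (hd xs))"
    if "length xs = Suc k" for xs
    using that by (cases xs) auto
  then have "recn (Suc k) (\<lambda>l. rec_nat (F (tl l)) (\<lambda>m r. G r m (tl l)) (hd l))"
    unfolding recn_def by blast
  \<comment> \<open>\<open>Prim\<close> recurses on the head of its argument list, so the list is
    rebuilt as \<open>N\<close> followed by all projections.\<close>
  then have "recn k (\<lambda>xs. (\<lambda>l. rec_nat (F (tl l)) (\<lambda>m r. G r m (tl l)) (hd l))
      (map (\<lambda>G. G xs) (N # map (\<lambda>i xs. xs ! i) [0..<k])))"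
    by (rule recn_compose) (auto intro: N recn_nth)
  then show ?thesis
    by (rule recn_cong) (auto simp: comp_def map_nth)
qed

lemma recn_add: "recn k F \<Longrightarrow> recn k G \<Longrightarrow> recn k (\<lambda>xs. F xs + G xs)"
proof -
  assume F: "recn k F" and G: "recn k G"
  have "recn k (\<lambda>xs. rec_nat (F xs) (\<lambda>m r. Suc r) (G xs))"
    by (rule recn_rec_nat[OF F _ G]) (intro recn_Suc recn_nth, simp)
  moreover have "rec_nat a (\<lambda>m r. Suc r) b = a + b" for a b :: nat by (induction b) auto
  ultimately show ?thesis by simp
qed

lemma recn_mult: "recn k F \<Longrightarrow> recn k G \<Longrightarrow> recn k (\<lambda>xs. F xs * G xs)"
proof -
  have "recn 2 (\<lambda>ys. rec_nat 0 (\<lambda>m r. r + ys ! 0) (ys ! 1))"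
  proof (rule recn_rec_nat)
    show "recn (Suc (Suc 2)) (\<lambda>l. l ! 0 + drop 2 l ! 0)"
      by (rule recn_cong[OF recn_add[OF recn_nth[of 0] recn_nth[of 2]]]) auto
  qed (auto intro: recn_zero recn_nth)
  moreover have "rec_nat 0 (\<lambda>m r. r + a) b = a * b" for a b :: nat by (induction b) auto
  ultimately have "recn 2 (\<lambda>ys. ys ! 0 * ys ! 1)" by simp
  then show "recn k F \<Longrightarrow> recn k G \<Longrightarrow> ?thesis" by (rule recn_compose2)
qed

lemma recn_pred: "recn k F \<Longrightarrow> recn k (\<lambda>xs. F xs - 1)"
proof -
  assume F: "recn k F"
  have "recn k (\<lambda>xs. rec_nat 0 (\<lambda>m r. m) (F xs))"
    by (rule recn_rec_nat[OF recn_zero _ F]) (intro recn_nth, simp)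
  moreover have "rec_nat 0 (\<lambda>m r. m) b = b - 1" for b :: nat by (cases b) auto
  ultimately show ?thesis by simp
qed

lemma recn_diff: "recn k F \<Longrightarrow> recn k G \<Longrightarrow> recn k (\<lambda>xs. F xs - G xs)"
proof -
  assume F: "recn k F" and G: "recn k G"
  have "recn k (\<lambda>xs. rec_nat (F xs) (\<lambda>m r. r - 1) (G xs))"
    by (rule recn_rec_nat[OF F _ G]) (intro recn_pred recn_nth, simp)
  moreover have "rec_nat a (\<lambda>m r. r - 1) b = a - b" for a b :: nat by (induction b) auto
  ultimately show ?thesis by simp
qed

lemma recn_if_zero:
  assumes "recn k P" "recn k F" "recn k G"
  shows "recn k (\<lambda>xs. if P xs = 0 then F xs else G xs)"
proof -
  \<comment> \<open>Subtraction is truncated: \<open>1 - P xs\<close> is the indicator of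
    \<open>P xs = 0\<close>, and applying it twice gives the complement.\<close>
  have "recn k (\<lambda>xs. F xs * (1 - P xs) + G xs * (1 - (1 - P xs)))"
    by (intro recn_add recn_mult recn_diff recn_const assms)
  then show ?thesis by (rule recn_cong) auto
qed

lemma recn_if_eq:
  assumes "recn k P" "recn k Q" "recn k F" "recn k G"
  shows "recn k (\<lambda>xs. if P xs = Q xs then F xs else G xs)"
proof -
  have "recn k (\<lambda>xs. if (P xs - Q xs) + (Q xs - P xs) = 0 then F xs else G xs)"
    by (intro recn_if_zero recn_add recn_diff assms)
  then show ?thesis by (rule recn_cong) auto
qed

lemma recn_prod_list: "\<forall>G\<in>set Gs. recn k G \<Longrightarrow> recn k (\<lambda>xs. prod_list (map (\<lambda>G. G xs) Gs))"
  by (induction Gs) (auto intro: recn_const recn_mult)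

lemma recn_ev_subst:
  assumes "recn (Suc k) (\<lambda>l. ev c (hd l) (tl l))" "recn j T" "length Gs = k" "\<forall>G\<in>set Gs. recn j G"
  shows "recn j (\<lambda>xs. ev c (T xs) (map (\<lambda>G. G xs) Gs))"
  using recn_compose[OF assms(1), of "T # Gs" j] assms(2-) by simp

lemma map_nth_shift:
  "length l = k + d \<Longrightarrow> map (\<lambda>G. G l) (map (\<lambda>i l. l ! (i + d)) [0..<k]) = drop d l"
  by (rule nth_equalityI) (auto simp: add.commute)

text \<open>The bound travels as an additional first argument. The arity varies in the induction
  because subcodes are called on argument lists of other lengths.\<close>

lemma recn_ev: "recn (Suc k) (\<lambda>l. ev c (hd l) (tl l))"
proof (induction c arbitrary: k)
  case Z show ?case by (simp add: recn_const)
next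
  case Sc
  show ?case
  proof (cases k)
    case 0 show ?thesis by (rule recn_cong[OF recn_zero]) (auto simp: 0 length_Suc_conv)
  next
    case (Suc j)
    have "recn (Suc k) (\<lambda>l. l ! 1 + 2)" using Suc by (intro recn_add recn_const recn_nth) simp
    then show ?thesis by (rule recn_cong) (auto simp: Suc length_Suc_conv)
  qed
next
  case (Proj i)
  show ?case
  proof (cases "i < k")
    case True
    then have "recn (Suc k) (\<lambda>l. Suc (l ! Suc i))" by (intro recn_Suc recn_nth) simp
    then show ?thesis by (rule recn_cong) (use True in \<open>auto simp: length_Suc_conv\<close>)
  next
    case False
    show ?thesis by (rule recn_cong[OF recn_zero]) (use False in auto)
  qed
next
  case (Comp f gs)
  let ?gs = "map (\<lambda>g l. ev g (hd l) (tl l)) gs"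
  \<comment> \<open>With shifted results, some argument is undefined exactly if the product is
    zero.\<close>
  have 1: "recn (Suc k) (\<lambda>xs. prod_list (map (\<lambda>G. G xs) ?gs))"
    by (rule recn_prod_list) (use Comp.IH(2) in auto)
  have 2: "recn (Suc k) (\<lambda>l. ev f (l ! 0) (map (\<lambda>G. G l) (map (\<lambda>g l. ev g (hd l) (tl l) - 1) gs)))"
    by (rule recn_ev_subst[OF Comp.IH(1) recn_nth]) (use Comp.IH(2) recn_pred in auto)
  have "recn (Suc k) (\<lambda>l. if prod_list (map (\<lambda>G. G l) ?gs) = 0 then 0 else
     ev f (l ! 0) (map (\<lambda>G. G l) (map (\<lambda>g l. ev g (hd l) (tl l) - 1) gs)))"
    by (rule recn_if_zero[OF 1 recn_zero 2])
  then show ?case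
    by (rule recn_cong) (auto simp: comp_def prod_list_zero_iff length_Suc_conv)
next
  case (Prim f g)
  show ?case
  proof (cases k)
    case 0 show ?thesis by (rule recn_cong[OF recn_zero]) (auto simp: 0 length_Suc_conv)
  next
    case (Suc j)
    \<comment> \<open>\<open>?d d\<close> skips \<open>d\<close> entries: the bound and the
      recursion variable in the base case, and in the step also the previous result and the counter,
      which stand in front of them.\<close>
    let ?d = "\<lambda>d. map (\<lambda>i l. l ! (i + d)) [0..<j] :: (nat list \<Rightarrow> nat) list"
    have d: "\<forall>G\<in>set (?d d). recn m G" if "j + d \<le> m" for d m using that by (auto intro!: recn_nth)
    have 1: "recn (Suc k) (\<lambda>l. ev f (l ! 0) (map (\<lambda>G. G l) (?d 2)))"
      by (rule recn_ev_subst[OF Prim.IH(1) recn_nth]) (use d[of 2] Suc in auto)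
    have 2: "recn (Suc (Suc (Suc k))) (\<lambda>l. ev g (l ! 2) (map (\<lambda>G. G l) ((\<lambda>l. l ! 0 - 1) # (\<lambda>l. l ! 1) # ?d 4)))"
      by (rule recn_ev_subst[OF Prim.IH(2) recn_nth]) (use d[of 4] Suc recn_pred recn_nth in auto)
    have "recn (Suc k) (\<lambda>l. rec_nat (ev f (l ! 0) (map (\<lambda>G. G l) (?d 2)))
       (\<lambda>m r. if r = 0 then 0 else ev g (l ! 0) ((r - 1) # m # map (\<lambda>G. G l) (?d 2))) (l ! 1))"
    proof (rule recn_rec_nat[OF 1])
      have "recn (Suc (Suc (Suc k))) (\<lambda>l. if l ! 0 = 0 then 0 else
        ev g (l ! 2) (map (\<lambda>G. G l) ((\<lambda>l. l ! 0 - 1) # (\<lambda>l. l ! 1) # ?d 4)))"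
        by (intro recn_if_zero recn_zero 2 recn_nth) simp
      then show "recn (Suc (Suc (Suc k))) (\<lambda>l. if l ! 0 = 0 then 0
           else ev g (drop 2 l ! 0) ((l ! 0 - 1) # l ! 1 # map (\<lambda>G. G (drop 2 l)) (?d 2)))"
      proof (rule recn_cong)
        fix l :: "nat list" assume l: "length l = Suc (Suc (Suc k))"
        have "map (\<lambda>G. G l) (?d 4) = drop 4 l" "map (\<lambda>G. G (drop 2 l)) (?d 2) = drop 2 (drop 2 l)"
          using l Suc by (intro map_nth_shift; simp)+
        then show "(if l ! 0 = 0 then 0 else
          ev g (l ! 2) (map (\<lambda>G. G l) ((\<lambda>l. l ! 0 - 1) # (\<lambda>l. l ! 1) # ?d 4))) =
          (if l ! 0 = 0 then 0
           else ev g (drop 2 l ! 0) ((l ! 0 - 1) # l ! 1 # map (\<lambda>G. G (drop 2 l)) (?d 2)))"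
          using l by (simp del: map_map)
      qed
    qed (simp add: recn_nth Suc)
    then show ?thesis
    proof (rule recn_cong)
      fix l :: "nat list" assume l: "length l = Suc k"
      have d: "map (\<lambda>G. G l) (?d 2) = drop 2 l" using l Suc by (intro map_nth_shift) simp
      obtain t n ys where "l = t # n # ys" using l Suc by (auto simp: length_Suc_conv)
      then show "rec_nat (ev f (l ! 0) (map (\<lambda>G. G l) (?d 2)))
       (\<lambda>m r. if r = 0 then 0 else ev g (l ! 0) ((r - 1) # m # map (\<lambda>G. G l) (?d 2))) (l ! 1)
        = ev (Prim f g) (hd l) (tl l)"
        unfolding d by (simp cong: if_cong)
    qed
  qed
next
  case (Mu f)
  \<comment> \<open>The three entries skipped are the loop state, the counter and the bound.\<close>
  let ?d = "map (\<lambda>i l. l ! (i + 3)) [0..<k] :: (nat list \<Rightarrow> nat) list"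
  have 2: "recn (Suc (Suc (Suc k))) (\<lambda>l. ev f (l ! 2) (map (\<lambda>G. G l) ((\<lambda>l. l ! 1) # ?d)))"
    by (rule recn_ev_subst[OF Mu.IH recn_nth]) (use recn_nth in auto)
  have 3: "recn (Suc (Suc (Suc k))) (\<lambda>l. ev f (l ! 2) (l ! 1 # drop 3 l))"
  proof (rule recn_cong[OF 2])
    fix l :: "nat list" assume l: "length l = Suc (Suc (Suc k))"
    have "map (\<lambda>G. G l) ?d = drop 3 l" using l by (intro map_nth_shift) simp
    then show "ev f (l ! 2) (map (\<lambda>G. G l) ((\<lambda>l. l ! 1) # ?d)) = ev f (l ! 2) (l ! 1 # drop 3 l)"
      by (simp del: map_map)
  qed
  have "recn (Suc k) (\<lambda>l. rec_nat 1 (\<lambda>m r. if r = 1 then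
     (if ev f (l ! 0) (m # tl l) = 0 then 0 else if ev f (l ! 0) (m # tl l) = 1 then m + 2 else 1) else r) (l ! 0) - 1)"
  proof (intro recn_pred recn_rec_nat[where F = "\<lambda>_. 1"] recn_const)
    have "recn (Suc (Suc (Suc k))) (\<lambda>l. if l ! 0 = 1 then
     (if ev f (l ! 2) (l ! 1 # drop 3 l) = 0 then 0 else if ev f (l ! 2) (l ! 1 # drop 3 l) = 1 then l ! 1 + 2 else 1) else l ! 0)"
      by (intro recn_if_zero recn_if_eq 3 recn_add recn_const recn_nth) auto
    then show "recn (Suc (Suc (Suc k))) (\<lambda>l. if l ! 0 = 1 then
     (if ev f (drop 2 l ! 0) (l ! 1 # tl (drop 2 l)) = 0 then 0
      else if ev f (drop 2 l ! 0) (l ! 1 # tl (drop 2 l)) = 1 then l ! 1 + 2 else 1) else l ! 0)"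
    proof (rule recn_cong)
      fix l :: "nat list" assume "length l = Suc (Suc (Suc k))"
      then have 1: "drop 2 l ! 0 = l ! 2" by simp
      have 2: "tl (drop 2 l) = drop 3 l" by (simp add: eval_nat_numeral drop_Suc tl_drop)
      show "(if l ! 0 = 1 then
     (if ev f (l ! 2) (l ! 1 # drop 3 l) = 0 then 0 else if ev f (l ! 2) (l ! 1 # drop 3 l) = 1 then l ! 1 + 2 else 1) else l ! 0)
      = (if l ! 0 = 1 then
     (if ev f (drop 2 l ! 0) (l ! 1 # tl (drop 2 l)) = 0 then 0
      else if ev f (drop 2 l ! 0) (l ! 1 # tl (drop 2 l)) = 1 then l ! 1 + 2 else 1) else l ! 0)"
        unfolding 1 2 ..
    qed
  qed (simp add: recn_nth)
  then show ?case by (rule recn_cong) (auto simp: length_Suc_conv cong: if_cong)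
qed

section \<open>Semidecidable predicates\<close>

abbreviation pair :: "nat \<Rightarrow> nat \<Rightarrow> nat" where "pair a b \<equiv> prod_encode (a, b)"
definition pfst :: "nat \<Rightarrow> nat" where "pfst p = fst (prod_decode p)"
definition psnd :: "nat \<Rightarrow> nat" where "psnd p = snd (prod_decode p)"

lemma pfst_pair [simp]: "pfst (pair a b) = a" and psnd_pair [simp]: "psnd (pair a b) = b"
  by (simp_all add: pfst_def psnd_def)

lemma pair_pfst_psnd: "pair (pfst p) (psnd p) = p"
  by (simp add: pfst_def psnd_def)

lemma recn_imp_computable1: "recn 1 (\<lambda>xs. f (xs ! 0)) \<Longrightarrow> computable1 f"
  unfolding recn_def computable1_def by (metis length_Cons list.size(3) nth_Cons_0 One_nat_def)

lemma computable1_imp_recn: "computable1 f \<Longrightarrow> recn 1 (\<lambda>xs. f (xs ! 0))"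
  unfolding recn_def computable1_def
  by (elim exE, rule exI) (auto simp: length_Suc_conv)

lemma computable1_iff_recn: "computable1 f \<longleftrightarrow> recn 1 (\<lambda>xs. f (xs ! 0))"
  using recn_imp_computable1 computable1_imp_recn by blast

lemma computable1_compose: "computable1 f \<Longrightarrow> computable1 g \<Longrightarrow> computable1 (\<lambda>x. f (g x))"
  unfolding computable1_iff_recn by (rule recn_compose1)

lemma computable1_const: "computable1 (\<lambda>x. a)"
  unfolding computable1_iff_recn by (rule recn_const)

lemma computable1_id: "computable1 (\<lambda>x. x)"
  unfolding computable1_iff_recn by (rule recn_nth) simp

lemma computable1_Suc: "computable1 f \<Longrightarrow> computable1 (\<lambda>x. Suc (f x))"
  unfolding computable1_iff_recn by (rule recn_Suc)

lemma computable1_add: "computable1 f \<Longrightarrow> computable1 g \<Longrightarrow> computable1 (\<lambda>x. f x + g x)"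
  unfolding computable1_iff_recn by (rule recn_add)

lemma computable1_mult: "computable1 f \<Longrightarrow> computable1 g \<Longrightarrow> computable1 (\<lambda>x. f x * g x)"
  unfolding computable1_iff_recn by (rule recn_mult)

lemma computable1_diff: "computable1 f \<Longrightarrow> computable1 g \<Longrightarrow> computable1 (\<lambda>x. f x - g x)"
  unfolding computable1_iff_recn by (rule recn_diff)

lemma recn_triangle: "recn k F \<Longrightarrow> recn k (\<lambda>xs. triangle (F xs))"
proof -
  assume F: "recn k F"
  have "recn k (\<lambda>xs. rec_nat 0 (\<lambda>m r. r + Suc m) (F xs))"
    by (rule recn_rec_nat[OF recn_zero _ F]) (intro recn_add recn_Suc recn_nth; simp)
  moreover have "rec_nat 0 (\<lambda>m r. r + Suc m) b = triangle b" for b by (induction b) auto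
  ultimately show ?thesis by simp
qed

lemma recn_pair: "recn k F \<Longrightarrow> recn k G \<Longrightarrow> recn k (\<lambda>xs. pair (F xs) (G xs))"
  unfolding prod_encode_def by simp (intro recn_add recn_triangle)

lemma computable1_pair: "computable1 f \<Longrightarrow> computable1 g \<Longrightarrow> computable1 (\<lambda>x. pair (f x) (g x))"
  unfolding computable1_iff_recn by (rule recn_pair)

text \<open>\<open>pfst p + psnd p\<close> is the number of the diagonal on which \<open>p\<close> lies, hence primitive recursive.\<close>

lemma diagonal_rec:
  "rec_nat 0 (\<lambda>m r. if triangle (Suc r) = Suc m then Suc r else r) p = pfst p + psnd p"
proof (induction p)
  case 0 show ?case by (simp add: pfst_def psnd_def prod_decode_def prod_decode_aux.simps)
next
  case (Suc p)
  obtain a b where p: "p = pair a b" by (metis pair_pfst_psnd)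
  have "Suc p = (if b = 0 then pair 0 (Suc a) else pair (Suc a) (b - 1))"
    unfolding p by (cases b) (auto simp: prod_encode_def)
  \<comment> \<open>A new diagonal starts at \<open>Suc p\<close> exactly if \<open>p\<close> is the
    last entry of its own, that is if \<open>b = 0\<close>.\<close>
  moreover have "triangle (Suc (a + b)) = Suc p \<longleftrightarrow> b = 0"
    unfolding p by (auto simp: prod_encode_def)
  ultimately have "pfst (Suc p) + psnd (Suc p) = (if triangle (Suc (a + b)) = Suc p then Suc (a + b) else a + b)"
    by simp
  moreover have "pfst p + psnd p = a + b" unfolding p by simp
  ultimately show ?case using Suc by (simp del: triangle_Suc)
qed

lemma computable1_diagonal: "computable1 (\<lambda>p. pfst p + psnd p)"
  unfolding diagonal_rec[symmetric] computable1_iff_recn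
  by (rule recn_rec_nat[OF recn_zero]) (intro recn_if_eq recn_triangle recn_Suc recn_nth; simp)+

lemma pfst_eq: "pfst p = p - triangle (pfst p + psnd p)"
  using pair_pfst_psnd[of p] unfolding prod_encode_def by simp

lemma computable1_pfst: "computable1 f \<Longrightarrow> computable1 (\<lambda>x. pfst (f x))"
proof (rule computable1_compose[of pfst])
  have "computable1 (\<lambda>p. p - triangle (pfst p + psnd p))"
    using computable1_diagonal unfolding computable1_iff_recn
    by (intro recn_diff recn_triangle recn_nth) auto
  then show "computable1 pfst" by (simp flip: pfst_eq)
qed

lemma computable1_psnd: "computable1 f \<Longrightarrow> computable1 (\<lambda>x. psnd (f x))"
  using computable1_compose[OF computable1_diff[OF computable1_diagonal computable1_pfst[OF computable1_id]], of f]
  by simp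

lemma computable1_rec_nat:
  assumes "computable1 F" "computable1 (\<lambda>p. G (pfst p) (pfst (psnd p)) (psnd (psnd p)))" "computable1 N"
  shows "computable1 (\<lambda>x. rec_nat (F x) (\<lambda>m r. G r m x) (N x))"
  unfolding computable1_iff_recn
proof (rule recn_rec_nat)
  show "recn 1 (\<lambda>xs. F (xs ! 0))" "recn 1 (\<lambda>xs. N (xs ! 0))"
    using assms(1,3) unfolding computable1_iff_recn .
  have "recn (Suc (Suc 1)) (\<lambda>l. (\<lambda>p. G (pfst p) (pfst (psnd p)) (psnd (psnd p)))
      (pair (l ! 0) (pair (l ! 1) (drop 2 l ! 0))))"
  proof (rule recn_compose1[of "\<lambda>p. G (pfst p) (pfst (psnd p)) (psnd (psnd p))"])
    show "recn (Suc (Suc 1)) (\<lambda>l. pair (l ! 0) (pair (l ! 1) (drop 2 l ! 0)))"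
      by (intro recn_pair recn_cong[OF recn_nth[of 2 "Suc (Suc 1)"]] recn_nth) auto
  qed (rule assms(2)[unfolded computable1_iff_recn])
  then show "recn (Suc (Suc 1)) (\<lambda>l. G (l ! 0) (l ! 1) (drop 2 l ! 0))" by simp
qed

lemma computable2_compose:
  assumes "computable2 f" "computable1 g" "computable1 h"
  shows "computable1 (\<lambda>x. f (g x) (h x))"
  using computable1_compose[OF assms(1)[unfolded computable2_def] computable1_pair[OF assms(2,3)]]
  by simp

section \<open>Decidable and semidecidable predicates and their closure properties\<close>

definition decidable :: "(nat \<Rightarrow> bool) \<Rightarrow> bool" where
  "decidable P \<longleftrightarrow> computable1 (\<lambda>x. if P x then 1 else 0)"

text \<open>In this projection form closure properties are manipulations of witnesses, without codes
  of machines. Agreement with \<open>ce_set\<close> is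
  \<open>ce_set_iff_semidecidable\<close>.\<close>

definition semidecidable :: "(nat \<Rightarrow> bool) \<Rightarrow> bool" where
  "semidecidable P \<longleftrightarrow> (\<exists>Q. decidable Q \<and> (\<forall>x. P x \<longleftrightarrow> (\<exists>t. Q (pair x t))))"

lemma decidable_compose: "decidable P \<Longrightarrow> computable1 f \<Longrightarrow> decidable (\<lambda>x. P (f x))"
  unfolding decidable_def by (rule computable1_compose)

lemma decidable_const: "decidable (\<lambda>x. b)"
  unfolding decidable_def by (rule computable1_const)

lemma decidable_eq: "computable1 f \<Longrightarrow> computable1 g \<Longrightarrow> decidable (\<lambda>x. f x = g x)"
  unfolding decidable_def computable1_iff_recn by (intro recn_if_eq recn_const)

lemma decidable_le: "computable1 f \<Longrightarrow> computable1 g \<Longrightarrow> decidable (\<lambda>x. f x \<le> g x)"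
  using decidable_eq[OF computable1_diff computable1_const[of 0]] by simp

lemma decidable_less: "computable1 f \<Longrightarrow> computable1 g \<Longrightarrow> decidable (\<lambda>x. f x < g x)"
  using decidable_le[OF computable1_Suc] by (simp add: Suc_le_eq)

lemma decidable_conj: "decidable P \<Longrightarrow> decidable Q \<Longrightarrow> decidable (\<lambda>x. P x \<and> Q x)"
proof -
  assume "decidable P" "decidable Q"
  then have "computable1 (\<lambda>x. (if P x then 1 else 0) * (if Q x then 1 else 0))"
    unfolding decidable_def by (rule computable1_mult)
  moreover have "(\<lambda>x. (if P x then 1 else 0) * (if Q x then 1 else 0)) = (\<lambda>x. if P x \<and> Q x then 1 else 0 :: nat)"
    by auto
  ultimately show ?thesis unfolding decidable_def by simp
qed

lemma decidable_not: "decidable P \<Longrightarrow> decidable (\<lambda>x. \<not> P x)"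
proof -
  assume "decidable P"
  then have "computable1 (\<lambda>x. 1 - (if P x then 1 else 0))"
    unfolding decidable_def by (intro computable1_diff computable1_const)
  moreover have "(\<lambda>x. 1 - (if P x then 1 else 0)) = (\<lambda>x. if \<not> P x then 1 else 0 :: nat)"
    by auto
  ultimately show ?thesis unfolding decidable_def by simp
qed

lemma decidable_disj: "decidable P \<Longrightarrow> decidable Q \<Longrightarrow> decidable (\<lambda>x. P x \<or> Q x)"
  using decidable_not[OF decidable_conj[OF decidable_not decidable_not], of P Q] by simp

lemma decidable_all_less:
  assumes "decidable (\<lambda>p. P (pfst p) (psnd p))" "computable1 N"
  shows "decidable (\<lambda>x. \<forall>k<N x. P x k)"
proof -
  have "computable1 (\<lambda>x. rec_nat 1 (\<lambda>m r. r * (if P x m then 1 else 0)) (N x))"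
  proof (rule computable1_rec_nat[OF computable1_const _ assms(2)])
    show "computable1 (\<lambda>p. pfst p * (if P (psnd (psnd p)) (pfst (psnd p)) then 1 else 0))"
      using computable1_compose[OF assms(1)[unfolded decidable_def], of
        "\<lambda>p. pair (psnd (psnd p)) (pfst (psnd p))"]
      by (intro computable1_mult computable1_pfst computable1_id)
        (simp add: computable1_pair computable1_pfst computable1_psnd computable1_id)
  qed
  moreover have "rec_nat 1 (\<lambda>m r. r * (if P x m then 1 else 0)) n = (if \<forall>k<n. P x k then 1 else 0 :: nat)" for x n
    by (induction n) (auto simp: less_Suc_eq)
  ultimately show ?thesis unfolding decidable_def by simp
qed

lemma decidable_ex_less:
  assumes "decidable (\<lambda>p. P (pfst p) (psnd p))" "computable1 N"
  shows "decidable (\<lambda>x. \<exists>k<N x. P x k)"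
  using decidable_not[OF decidable_all_less[OF decidable_not[OF assms(1)] assms(2)]] by simp

lemmas computable1_intros = computable1_id computable1_const computable1_Suc computable1_add
  computable1_mult computable1_diff computable1_pair computable1_pfst computable1_psnd

lemma semidecidableI:
  assumes "decidable (\<lambda>p. Q (pfst p) (psnd p))" "\<And>x. P x \<longleftrightarrow> (\<exists>t. Q x t)"
  shows "semidecidable P"
  unfolding semidecidable_def using assms by (intro exI[of _ "\<lambda>p. Q (pfst p) (psnd p)"]) simp

lemma decidable_compose2:
  assumes "decidable (\<lambda>p. Q (pfst p) (psnd p))" "computable1 f" "computable1 g"
  shows "decidable (\<lambda>x. Q (f x) (g x))"
  using decidable_compose[OF assms(1) computable1_pair[OF assms(2,3)]] by simp

lemma semidecidableE:
  assumes "semidecidable P"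
  obtains Q where "decidable (\<lambda>p. Q (pfst p) (psnd p))" "\<forall>x. P x \<longleftrightarrow> (\<exists>t. Q x t)"
proof -
  obtain R where R: "decidable R" "\<And>x. P x \<longleftrightarrow> (\<exists>t. R (pair x t))"
    using assms unfolding semidecidable_def by blast
  show ?thesis
    by (rule that[of "\<lambda>x t. R (pair x t)"]) (simp_all add: pair_pfst_psnd R)
qed

lemma semidecidable_decidable: "decidable P \<Longrightarrow> semidecidable P"
  by (rule semidecidableI[of "\<lambda>x t. P x"]) (simp_all add: decidable_compose[of P] computable1_pfst computable1_id)

lemma semidecidable_ex:
  assumes "semidecidable (\<lambda>p. P (pfst p) (psnd p))"
  shows "semidecidable (\<lambda>x. \<exists>y. P x y)"
proof -
  obtain Q where Q0: "decidable (\<lambda>p. Q (pfst p) (psnd p))"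
    "\<forall>x. P (pfst x) (psnd x) \<longleftrightarrow> (\<exists>t. Q x t)"
    using assms by (rule semidecidableE)
  note Q = decidable_compose2[OF Q0(1)] Q0(2)[rule_format]
  have P: "P x y \<longleftrightarrow> (\<exists>t. Q (pair x y) t)" for x y
    using Q(2)[of "pair x y"] by simp
  show ?thesis
  proof (rule semidecidableI)
    show "decidable (\<lambda>p. Q (pair (pfst p) (pfst (psnd p))) (psnd (psnd p)))"
      by (intro Q(1) computable1_intros)
    show "(\<exists>y. P x y) \<longleftrightarrow> (\<exists>t. Q (pair x (pfst t)) (psnd t))" for x
      unfolding P by (metis pfst_pair psnd_pair)
  qed
qed

lemma semidecidable_compose: "semidecidable P \<Longrightarrow> computable1 f \<Longrightarrow> semidecidable (\<lambda>x. P (f x))"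
proof -
  assume "semidecidable P" and f: "computable1 f"
  then obtain Q where Q0: "decidable (\<lambda>p. Q (pfst p) (psnd p))" "\<forall>x. P x \<longleftrightarrow> (\<exists>t. Q x t)"
    by (elim semidecidableE)
  show ?thesis
  proof (rule semidecidableI)
    show "decidable (\<lambda>p. Q (f (pfst p)) (psnd p))"
      by (intro decidable_compose2[OF Q0(1)] computable1_compose[OF f] computable1_intros)
  qed (use Q0(2) in blast)
qed

lemma semidecidable_conj:
  assumes "semidecidable P" "semidecidable Q"
  shows "semidecidable (\<lambda>x. P x \<and> Q x)"
proof -
  obtain A where A0: "decidable (\<lambda>p. A (pfst p) (psnd p))"
    "\<forall>x. P x \<longleftrightarrow> (\<exists>t. A x t)"
    using assms(1) by (rule semidecidableE)
  note A = decidable_compose2[OF A0(1)] A0(2)[rule_format]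
  obtain B where B0: "decidable (\<lambda>p. B (pfst p) (psnd p))"
    "\<forall>x. Q x \<longleftrightarrow> (\<exists>t. B x t)"
    using assms(2) by (rule semidecidableE)
  note B = decidable_compose2[OF B0(1)] B0(2)[rule_format]
  show ?thesis
  proof (rule semidecidableI)
    show "decidable (\<lambda>p. A (pfst p) (pfst (psnd p)) \<and> B (pfst p) (psnd (psnd p)))"
      by (intro A(1) B(1) decidable_conj computable1_intros)
    show "P x \<and> Q x \<longleftrightarrow> (\<exists>t. A x (pfst t) \<and> B x (psnd t))" for x
      unfolding A(2) B(2) by (metis pfst_pair psnd_pair)
  qed
qed

lemma semidecidable_disj:
  assumes "semidecidable P" "semidecidable Q"
  shows "semidecidable (\<lambda>x. P x \<or> Q x)"
proof -
  obtain A where A0: "decidable (\<lambda>p. A (pfst p) (psnd p))"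
    "\<forall>x. P x \<longleftrightarrow> (\<exists>t. A x t)"
    using assms(1) by (rule semidecidableE)
  note A = decidable_compose2[OF A0(1)] A0(2)[rule_format]
  obtain B where B0: "decidable (\<lambda>p. B (pfst p) (psnd p))"
    "\<forall>x. Q x \<longleftrightarrow> (\<exists>t. B x t)"
    using assms(2) by (rule semidecidableE)
  note B = decidable_compose2[OF B0(1)] B0(2)[rule_format]
  show ?thesis
  proof (rule semidecidableI)
    show "decidable (\<lambda>p. A (pfst p) (psnd p) \<or> B (pfst p) (psnd p))"
      by (intro A(1) B(1) decidable_disj computable1_intros)
    show "P x \<or> Q x \<longleftrightarrow> (\<exists>t. A x t \<or> B x t)" for x
      unfolding A(2) B(2) by blast
  qed
qed

text \<open>Finitely many searches merge into one search for a common bound on all their witnesses;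
  below a given bound everything is decidable. The sum of the witnesses supplies such a
  bound.\<close>

lemma semidecidable_all_less:
  assumes "semidecidable (\<lambda>p. P (pfst p) (psnd p))" "computable1 N"
  shows "semidecidable (\<lambda>x. \<forall>k<N x. P x k)"
proof -
  obtain Q where Q0: "decidable (\<lambda>p. Q (pfst p) (psnd p))"
    "\<forall>x. P (pfst x) (psnd x) \<longleftrightarrow> (\<exists>t. Q x t)"
    using assms(1) by (rule semidecidableE)
  note Q = decidable_compose2[OF Q0(1)] Q0(2)[rule_format]
  have P: "P x y \<longleftrightarrow> (\<exists>t. Q (pair x y) t)" for x y
    using Q(2)[of "pair x y"] by simp
  show ?thesis
  proof (rule semidecidableI)
    show "decidable (\<lambda>p. \<forall>k<N (pfst p). \<exists>t<psnd p. Q (pair (pfst p) k) t)"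
      by (intro decidable_all_less decidable_ex_less Q(1) computable1_intros computable1_compose[OF assms(2)])
    show "(\<forall>k<N x. P x k) \<longleftrightarrow> (\<exists>T. \<forall>k<N x. \<exists>t<T. Q (pair x k) t)" for x
    proof
      assume "\<forall>k<N x. P x k"
      then obtain t where t: "\<forall>k<N x. Q (pair x k) (t k)" unfolding P by metis
      have "t k < Suc (\<Sum>k<N x. t k)" if "k < N x" for k
        using that member_le_sum[of k "{..<N x}" t] by simp
      then show "\<exists>T. \<forall>k<N x. \<exists>t<T. Q (pair x k) t" using t by blast
    qed (auto simp: P)
  qed
qed

lemma semidecidable_const: "semidecidable (\<lambda>x. b)"
  by (intro semidecidable_decidable decidable_const)

lemma semidecidable_ball_finite:
  "finite A \<Longrightarrow> (\<And>a. a \<in> A \<Longrightarrow> semidecidable (P a)) \<Longrightarrow> semidecidable (\<lambda>x. \<forall>a\<in>A. P a x)"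
  by (induction rule: finite_induct) (simp_all add: semidecidable_const semidecidable_conj)

lemma semidecidable_bex_finite:
  "finite A \<Longrightarrow> (\<And>a. a \<in> A \<Longrightarrow> semidecidable (P a)) \<Longrightarrow> semidecidable (\<lambda>x. \<exists>a\<in>A. P a x)"
  by (induction rule: finite_induct) (simp_all add: semidecidable_const semidecidable_disj)

inductive_cases reval_MuE: "reval (Mu c) xs y"

text \<open>From left to right the witness is a bound at which \<open>ev\<close> succeeds, which is
  decidable; from right to left \<open>Mu\<close> searches for the witness.\<close>

lemma ce_set_iff_semidecidable: "ce_set A \<longleftrightarrow> semidecidable (\<lambda>x. x \<in> A)"
proof
  assume "ce_set A"
  then obtain c where c: "\<And>x. x \<in> A \<longleftrightarrow> (\<exists>y. reval c [x] y)" unfolding ce_set_def by blast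
  show "semidecidable (\<lambda>x. x \<in> A)"
  proof (rule semidecidableI)
    have "recn 2 (\<lambda>l. ev c (hd l) (tl l))" using recn_ev[of 1 c] by (simp add: numeral_2_eq_2)
    then have "recn 2 (\<lambda>l. ev c (l ! 0) [l ! 1])"
      by (rule recn_cong) (auto simp: length_Suc_conv numeral_2_eq_2)
    from recn_compose2[OF this, of 1 "\<lambda>xs. psnd (xs ! 0)" "\<lambda>xs. pfst (xs ! 0)"]
    have "computable1 (\<lambda>p. ev c (psnd p) [pfst p])"
      using computable1_psnd[OF computable1_id] computable1_pfst[OF computable1_id]
      unfolding computable1_iff_recn by simp
    then show "decidable (\<lambda>p. ev c (psnd p) [pfst p] \<noteq> 0)"
      by (intro decidable_not decidable_eq computable1_const)
    show "x \<in> A \<longleftrightarrow> (\<exists>t. ev c t [x] \<noteq> 0)" for x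
    proof
      assume "x \<in> A"
      then obtain y where "\<forall>\<^sub>F t in sequentially. ev c t [x] = Suc y" using c ev_complete by blast
      then show "\<exists>t. ev c t [x] \<noteq> 0" unfolding eventually_sequentially by (metis nat.simps(3) order_refl)
    next
      assume "\<exists>t. ev c t [x] \<noteq> 0"
      then obtain t y where "ev c t [x] = Suc y" using not0_implies_Suc by blast
      then show "x \<in> A" using ev_sound c by blast
    qed
  qed
next
  assume "semidecidable (\<lambda>x. x \<in> A)"
  then obtain Q where Q0: "decidable (\<lambda>p. Q (pfst p) (psnd p))"
    "\<forall>x. x \<in> A \<longleftrightarrow> (\<exists>t. Q x t)"
    by (rule semidecidableE)
  note Q = decidable_compose2[OF Q0(1)] Q0(2)[rule_format]
  \<comment> \<open>\<open>Mu\<close> looks for a zero in the first argument, hence the negated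
    characteristic function with the witness in front.\<close>
  have "computable1 (\<lambda>p. if \<not> Q (psnd p) (pfst p) then 1 else 0)"
    using decidable_not[OF Q(1)[OF computable1_psnd[OF computable1_id] computable1_pfst[OF computable1_id]]]
    unfolding decidable_def .
  from recn_compose1[OF this[unfolded computable1_iff_recn] recn_pair[OF recn_nth[of 0 2] recn_nth[of 1 2]]]
  have "recn 2 (\<lambda>l. if \<not> Q (l ! 1) (l ! 0) then 1 else 0)" by simp
  then obtain c where "\<forall>l. length l = 2 \<longrightarrow> reval c l (if \<not> Q (l ! 1) (l ! 0) then 1 else 0)"
    unfolding recn_def by blast
  then have c: "reval c [t, x] (if Q x t then 0 else 1)" for t x
    by (elim allE[of _ "[t, x]"]) (simp split: if_splits)
  \<comment> \<open>Uniqueness of results comes from \<open>ev_complete\<close>: two results would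
    both be the eventual value of the function \<open>ev\<close>.\<close>
  have c0: "reval c [t, x] y \<Longrightarrow> y = (if Q x t then 0 else 1)" for t x y
  proof -
    assume "reval c [t, x] y"
    then have "\<forall>\<^sub>F s in sequentially. ev c s [t, x] = Suc y" by (rule ev_complete)
    moreover have "\<forall>\<^sub>F s in sequentially. ev c s [t, x] = Suc (if Q x t then 0 else 1)"
      using ev_complete[OF c] .
    ultimately have "\<forall>\<^sub>F s in sequentially. y = (if Q x t then 0 else 1)"
      by eventually_elim simp
    then show ?thesis by simp
  qed
  have "x \<in> A \<longleftrightarrow> (\<exists>y. reval (Mu c) [x] y)" for x
  proof
    assume "x \<in> A"
    then have ex: "\<exists>t. Q x t" by (simp add: Q(2))
    define n where "n = (LEAST t. Q x t)"
    have "Q x n" unfolding n_def using ex by (rule LeastI_ex)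
    moreover have "\<forall>m<n. \<not> Q x m" unfolding n_def using not_less_Least by blast
    ultimately have "reval c [n, x] 0" "\<forall>m<n. reval c [m, x] (Suc 0)"
      using c[of n x] c[of _ x] by (simp, metis One_nat_def)
    then have "reval c [n, x] 0" "\<forall>m<n. \<exists>k. reval c [m, x] (Suc k)" by blast+
    then have "reval (Mu c) [x] n" by (rule reval_Mu)
    then show "\<exists>y. reval (Mu c) [x] y" ..
  next
    assume "\<exists>y. reval (Mu c) [x] y"
    then obtain y where "reval c [y, x] 0" by (elim exE reval_MuE)
    then have "Q x y" using c0[of y x 0] by (auto split: if_splits)
    then show "x \<in> A" using Q(2) by blast
  qed
  then show "ce_set A" unfolding ce_set_def by blast
qed

section \<open>Effective covers in computable metric spaces\<close>

lemma computable1_power2: "computable1 f \<Longrightarrow> computable1 (\<lambda>x. 2 ^ f x)"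
proof -
  assume f: "computable1 f"
  have "computable1 (\<lambda>x. rec_nat 1 (\<lambda>m r. 2 * r) (f x))"
    by (rule computable1_rec_nat[OF computable1_const _ f]) (intro computable1_intros)
  moreover have "rec_nat 1 (\<lambda>m r. 2 * r) k = (2::nat) ^ k" for k by (induction k) auto
  ultimately show ?thesis by simp
qed

text \<open>\<open>int_decode\<close> places the nonnegative integers on the even numbers, so
  \<open>y + y\<close> is the code of the numerator \<open>y\<close>.\<close>

lemma rat_of_code_double: "pfst c = y + y \<Longrightarrow> rat_of_code c = of_nat y / of_nat (Suc (psnd c))"
  unfolding rat_of_code_def pfst_def psnd_def
  by (simp add: case_prod_beta int_decode_def sum_decode_def)

lemma rat_of_code_pos:
  assumes "rat_of_code c > 0"
  obtains y where "pfst c = y + y"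
proof (cases "even (pfst c)")
  case False
  then have "int_decode (pfst c) < 0"
    by (simp add: int_decode_def sum_decode_def)
  then have "rat_of_code c < 0"
    unfolding rat_of_code_def pfst_def by (simp add: case_prod_beta divide_neg_pos)
  then show ?thesis using assms by simp
next
  case True
  then show ?thesis using that by (metis evenE mult_2)
qed

text \<open>Clearing denominators turns the comparison of coded rationals into one of natural
  numbers, which is decidable. The halves \<open>u\<close>, \<open>v\<close>, \<open>y\<close> will
  be searched for, which spares a computable division by two.\<close>

lemma rat_code_inequality:
  assumes "pfst a = u + u" "pfst b = v + v" "pfst c = y + y"
  shows "rat_of_code c > 1 / 2 ^ k + rat_of_code a + rat_of_code b \<longleftrightarrow>
    Suc (psnd c) * (Suc (psnd a) * Suc (psnd b) + 2 ^ k * (u * Suc (psnd b) + v * Suc (psnd a)))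
      < y * 2 ^ k * Suc (psnd a) * Suc (psnd b)" (is "_ \<longleftrightarrow> ?L < ?R")
proof -
  define A B C where ABC: "A = Suc (psnd a)" "B = Suc (psnd b)" "C = Suc (psnd c)"
  have p: "(of_nat A :: rat) > 0" "(of_nat B :: rat) > 0" "(of_nat C :: rat) > 0"
    by (simp_all add: ABC del: of_nat_Suc)
  have "1 / 2 ^ k + rat_of_code a + rat_of_code b
      = (of_nat A * of_nat B + 2 ^ k * (of_nat u * of_nat B + of_nat v * of_nat A)) / (2 ^ k * of_nat A * of_nat B)"
    using p unfolding rat_of_code_double[OF assms(1)] rat_of_code_double[OF assms(2)] ABC[symmetric]
    by (simp add: field_simps)
  moreover have "rat_of_code c = of_nat y / of_nat C"
    unfolding rat_of_code_double[OF assms(3)] ABC ..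
  ultimately have "rat_of_code c > 1 / 2 ^ k + rat_of_code a + rat_of_code b \<longleftrightarrow>
    (of_nat C * (of_nat A * of_nat B + 2 ^ k * (of_nat u * of_nat B + of_nat v * of_nat A)) :: rat)
     < of_nat y * 2 ^ k * of_nat A * of_nat B"
    using p by (simp add: divide_less_eq less_divide_eq mult.commute mult.left_commute mult.assoc)
  also have "\<dots> \<longleftrightarrow> (of_nat (C * (A * B + 2 ^ k * (u * B + v * A))) :: rat) < of_nat (y * 2 ^ k * A * B)"
    by simp
  finally show ?thesis unfolding of_nat_less_iff ABC .
qed

section \<open>Rational balls, finite covers and formal disjointness\<close>

locale effective_space =
  fixes \<alpha> :: "nat \<Rightarrow> 'a::metric_space" and q :: "nat \<Rightarrow> rat" and \<tau>1 \<tau>2 :: "nat \<Rightarrow> nat"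
    and \<sigma> :: "nat \<Rightarrow> nat \<Rightarrow> nat" and \<eta> :: "nat \<Rightarrow> nat"
  assumes enum: "enum_data q \<tau>1 \<tau>2 \<sigma> \<eta>" and cms: "computable_metric_space \<alpha>"
begin

abbreviation cen :: "nat \<Rightarrow> 'a" where "cen i \<equiv> \<alpha> (\<tau>1 i)"
abbreviation rad :: "nat \<Rightarrow> real" where "rad i \<equiv> real_of_rat (q (\<tau>2 i))"
abbreviation I :: "nat \<Rightarrow> 'a set" where "I \<equiv> ballI \<alpha> q \<tau>1 \<tau>2"
abbreviation J :: "nat \<Rightarrow> 'a set" where "J \<equiv> unionJ \<alpha> q \<tau>1 \<tau>2 \<sigma> \<eta>"

text \<open>The last entry of the \<open>j\<close>-th sequence is dropped, so that the empty set has a code as well.\<close>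
definition fin :: "nat \<Rightarrow> nat set" where "fin j = \<sigma> j ` {..<\<eta> j}"

text \<open>The half of \<open>computable_compact\<close> that a co-c.e. closed set inherits from a
  computable compact superset; see \<open>usc_coce_closed\<close>.\<close>

definition usc :: "'a set \<Rightarrow> bool" where
  "usc K \<longleftrightarrow> compact K \<and> semidecidable (\<lambda>j. K \<subseteq> J j)"

text \<open>A condition on the indices rather than on the balls as sets. It implies disjointness by
  the triangle inequality, and as a strict inequality between computable reals it can be confirmed
  by a search.\<close>

definition formally_disjoint :: "nat \<Rightarrow> nat \<Rightarrow> bool" where
  "formally_disjoint i j \<longleftrightarrow> rad i + rad j < dist (cen i) (cen j)"

lemma computable_\<tau>1: "computable1 f \<Longrightarrow> computable1 (\<lambda>x. \<tau>1 (f x))"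
  and computable_\<tau>2: "computable1 f \<Longrightarrow> computable1 (\<lambda>x. \<tau>2 (f x))"
  and computable_\<eta>: "computable1 f \<Longrightarrow> computable1 (\<lambda>x. \<eta> (f x))"
  and computable_\<sigma>: "computable1 f \<Longrightarrow> computable1 g \<Longrightarrow> computable1 (\<lambda>x. \<sigma> (f x) (g x))"
  using enum unfolding enum_data_def by (blast intro: computable1_compose computable2_compose)+

lemmas computable_intros = computable_\<tau>1 computable_\<tau>2 computable_\<eta> computable_\<sigma> computable1_intros

lemma q_pos: "q i > 0"
  using enum unfolding enum_data_def by blast

lemma seq_surj: "xs \<noteq> [] \<Longrightarrow> \<exists>j. map (\<sigma> j) [0..<Suc (\<eta> j)] = xs"
proof -
  assume "xs \<noteq> []"
  then have "xs \<in> range (\<lambda>j. map (\<sigma> j) [0..<Suc (\<eta> j)])"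
    using enum unfolding enum_data_def by blast
  then show ?thesis by (elim rangeE) (metis)
qed

lemma fin_surj: "finite A \<Longrightarrow> \<exists>j. fin j = A"
proof -
  assume "finite A"
  then obtain xs where xs: "set xs = A" using finite_list by blast
  obtain j where j: "map (\<sigma> j) [0..<Suc (\<eta> j)] = xs @ [0]" using seq_surj[of "xs @ [0]"] by blast
  then have "map (\<sigma> j) [0..<\<eta> j] = xs" by simp
  then show ?thesis unfolding fin_def xs[symmetric] by (metis atLeast_upt list.set_map lessThan_atLeast0 set_upt)
qed

text \<open>A sequence of codes is itself coded by one number, so the search for a whole family of
  finite sets becomes a search over a single variable.\<close>

lemma fin_family_surj:
  assumes "N > 0" "\<And>m. m < N \<Longrightarrow> finite (B m)"
  shows "\<exists>e. \<forall>m<N. fin (\<sigma> e m) = B m"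
proof -
  have "\<forall>m. \<exists>c. m < N \<longrightarrow> fin c = B m" using fin_surj[OF assms(2)] by blast
  then obtain c where c: "\<And>m. m < N \<Longrightarrow> fin (c m) = B m" by metis
  obtain e where e: "map (\<sigma> e) [0..<Suc (\<eta> e)] = map c [0..<N]"
    using seq_surj[of "map c [0..<N]"] assms(1) by auto
  then have "Suc (\<eta> e) = N" by (metis length_map length_upt diff_zero)
  then have "\<sigma> e m = c m" if "m < N" for m
    using that arg_cong[OF e, of "\<lambda>xs. xs ! m"] by (simp del: upt_Suc)
  then show ?thesis using c by metis
qed

lemma semidecidable_fin_ball:
  assumes "semidecidable (\<lambda>p. P (pfst p) (psnd p))" "computable1 f"
  shows "semidecidable (\<lambda>x. \<forall>a\<in>fin (f x). P x a)"
proof -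
  have "semidecidable (\<lambda>x. \<forall>k<\<eta> (f x). P x (\<sigma> (f x) k))"
  proof (rule semidecidable_all_less)
    have "semidecidable (\<lambda>p. P (pfst (pair (pfst p) (\<sigma> (f (pfst p)) (psnd p)))) (psnd (pair (pfst p) (\<sigma> (f (pfst p)) (psnd p)))))"
      by (rule semidecidable_compose[OF assms(1)]) (intro computable_intros computable1_compose[OF assms(2)])
    then show "semidecidable (\<lambda>p. P (pfst p) (\<sigma> (f (pfst p)) (psnd p)))" by simp
  qed (intro computable_intros assms(2))
  then show ?thesis by (simp add: fin_def lessThan_def)
qed

lemma decidable_in_fin: "computable1 f \<Longrightarrow> computable1 g \<Longrightarrow> decidable (\<lambda>x. g x \<in> fin (f x))"
proof -
  assume f: "computable1 f" and g: "computable1 g"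
  have "decidable (\<lambda>x. \<exists>k<\<eta> (f x). g x = \<sigma> (f x) k)"
    by (intro decidable_ex_less decidable_eq computable_intros computable1_compose[OF f] computable1_compose[OF g] f)
  then show ?thesis by (simp add: fin_def image_iff Bex_def)
qed

lemma J_eq: "J j = (\<Union>k<Suc (\<eta> j). I (\<sigma> j k))"
proof -
  have "{\<sigma> j k |k. k \<le> \<eta> j} = \<sigma> j ` {..<Suc (\<eta> j)}"
    unfolding image_def by (auto simp: less_Suc_eq_le)
  then show ?thesis unfolding unionJ_def by simp
qed

lemma open_I: "open (I i)"
  unfolding ballI_def by simp

text \<open>The family of balls may be infinite. By compactness a finite subfamily suffices, and one
  searches for a \<open>j\<close> that covers \<open>K\<close> and whose members are all confirmed
  to satisfy \<open>M x\<close>.\<close>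

lemma semidecidable_cover:
  assumes "usc K" "semidecidable (\<lambda>p. M (pfst p) (psnd p))"
  shows "semidecidable (\<lambda>x. K \<subseteq> (\<Union>l\<in>Collect (M x). I l))"
proof (cases "K = {}")
  \<comment> \<open>Each \<open>J j\<close> has at least one member, so the search below could fail
    for an empty \<open>K\<close> when nothing satisfies \<open>M x\<close>.\<close>
  case True
  then show ?thesis by (simp add: semidecidable_const)
next
  case False
  have "K \<subseteq> (\<Union>l\<in>Collect (M x). I l) \<longleftrightarrow> (\<exists>j. K \<subseteq> J j \<and> (\<forall>k<Suc (\<eta> j). M x (\<sigma> j k)))" for x
  proof
    assume "K \<subseteq> (\<Union>l\<in>Collect (M x). I l)"
    then obtain A where A: "A \<subseteq> Collect (M x)" "finite A" "K \<subseteq> (\<Union>l\<in>A. I l)"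
      using compactE_image[of K "Collect (M x)" I] assms(1) open_I unfolding usc_def by metis
    obtain xs where xs: "set xs = A" using A(2) finite_list by blast
    have "xs \<noteq> []" using xs A(3) False by auto
    then obtain j where "map (\<sigma> j) [0..<Suc (\<eta> j)] = xs" using seq_surj by blast
    then have "A = \<sigma> j ` {..<Suc (\<eta> j)}"
      unfolding xs[symmetric] by (metis list.set_map atLeast_upt)
    then show "\<exists>j. K \<subseteq> J j \<and> (\<forall>k<Suc (\<eta> j). M x (\<sigma> j k))"
      using A(1,3) unfolding J_eq by (intro exI[of _ j]) auto
  next
    assume "\<exists>j. K \<subseteq> J j \<and> (\<forall>k<Suc (\<eta> j). M x (\<sigma> j k))"
    then show "K \<subseteq> (\<Union>l\<in>Collect (M x). I l)" unfolding J_eq by blast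
  qed
  moreover have "semidecidable (\<lambda>x. \<exists>j. K \<subseteq> J j \<and> (\<forall>k<Suc (\<eta> j). M x (\<sigma> j k)))"
  proof (intro semidecidable_ex semidecidable_conj semidecidable_all_less)
    show "semidecidable (\<lambda>p. K \<subseteq> J (psnd p))"
      using assms(1) semidecidable_compose[of "\<lambda>j. K \<subseteq> J j", OF _ computable1_psnd[OF computable1_id]]
      unfolding usc_def by blast
    have "semidecidable (\<lambda>p. (\<lambda>p. M (pfst p) (psnd p)) (pair (pfst (pfst p)) (\<sigma> (psnd (pfst p)) (psnd p))))"
      by (intro semidecidable_compose[OF assms(2)] computable_intros)
    then show "semidecidable (\<lambda>p. M (pfst (pfst p)) (\<sigma> (psnd (pfst p)) (psnd p)))" by simp
  qed (intro computable_intros)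
  ultimately show ?thesis by simp
qed

text \<open>\<open>K\<close> lies in \<open>J j\<close> exactly if \<open>L\<close> lies in the
  union of \<open>J j\<close> and the complement of \<open>K\<close>, and that complement is an
  effective union of balls. So the question about \<open>K\<close> becomes a covering question about
  \<open>L\<close>.\<close>

lemma usc_coce_closed:
  assumes "computable_compact \<alpha> q \<tau>1 \<tau>2 \<sigma> \<eta> L" "coce_closed \<alpha> q \<tau>1 \<tau>2 K" "K \<subseteq> L"
  shows "usc K"
proof -
  obtain f where f: "computable1 f" "- K = (\<Union>i. I (f i))" and "closed K"
    using assms(2) unfolding coce_closed_def by blast
  have "usc L" using assms(1) unfolding computable_compact_def usc_def by (simp add: ce_set_iff_semidecidable)
  let ?M = "\<lambda>j l. (\<exists>k<Suc (\<eta> j). l = \<sigma> j k) \<or> (\<exists>i. l = f i)"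
  have "semidecidable (\<lambda>j. L \<subseteq> (\<Union>l\<in>Collect (?M j). I l))"
    by (intro semidecidable_cover[OF \<open>usc L\<close>] semidecidable_disj semidecidable_ex semidecidable_decidable
        decidable_ex_less decidable_eq computable_intros computable1_compose[OF f(1)])
  moreover have "L \<subseteq> (\<Union>l\<in>Collect (?M j). I l) \<longleftrightarrow> K \<subseteq> J j" for j
  proof -
    have "(\<Union>l\<in>Collect (?M j). I l) = J j \<union> - K" unfolding f(2) J_eq by blast
    then show ?thesis using assms(3) by blast
  qed
  moreover have "compact K"
    using assms(1,3) \<open>closed K\<close> compact_Int_closed[of L K] unfolding computable_compact_def
    by (simp add: Int_absorb1)
  ultimately show ?thesis unfolding usc_def by simp
qed

text \<open>The search is for a precision \<open>k\<close> at which the approximate distance exceeds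
  the sum of the radii by more than the error \<open>1 / 2 ^ k\<close>.\<close>

lemma semidecidable_formally_disjoint:
  assumes f: "computable1 f" and g: "computable1 g"
  shows "semidecidable (\<lambda>x. formally_disjoint (f x) (g x))"
proof -
  obtain G where G: "computable_rat3 G" "\<And>x y i. \<bar>dist (\<alpha> x) (\<alpha> y) - real_of_rat (G x y i)\<bar> < 1 / 2 ^ i"
    using cms unfolding computable_metric_space_def computable_real2_def by blast
  obtain h where h: "computable1 h" "\<And>n. (case prod_decode n of (i, p) \<Rightarrow> (case prod_decode p of (j, k) \<Rightarrow> G i j k)) = rat_of_code (h n)"
    using G(1) unfolding computable_rat3_def computable_rat1_def by blast
  have hG: "G i j k = rat_of_code (h (pair i (pair j k)))" for i j k
    using h(2)[of "pair i (pair j k)"] by simp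
  obtain hq where hq: "computable1 hq" "\<And>n. q n = rat_of_code (hq n)"
    using enum unfolding enum_data_def computable_rat1_def by blast
  let ?a = "\<lambda>x. hq (\<tau>2 (f x))" and ?b = "\<lambda>x. hq (\<tau>2 (g x))"
    and ?c = "\<lambda>x k. h (pair (\<tau>1 (f x)) (pair (\<tau>1 (g x)) k))"
  have "formally_disjoint (f x) (g x) \<longleftrightarrow> (\<exists>k. \<exists>u. \<exists>v. \<exists>y. pfst (?a x) = u + u \<and> pfst (?b x) = v + v \<and>
      pfst (?c x k) = y + y \<and>
      Suc (psnd (?c x k)) * (Suc (psnd (?a x)) * Suc (psnd (?b x)) + 2 ^ k * (u * Suc (psnd (?b x)) + v * Suc (psnd (?a x))))
      < y * 2 ^ k * Suc (psnd (?a x)) * Suc (psnd (?b x)))" (is "_ \<longleftrightarrow> ?R x") for x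
  proof
    assume "formally_disjoint (f x) (g x)"
    then have "0 < dist (cen (f x)) (cen (g x)) - (rad (f x) + rad (g x))" (is "0 < ?d")
      unfolding formally_disjoint_def by simp
    then obtain k where "inverse (2 ^ k) < ?d / 2" using reals_power_lt_ex[of "?d / 2" 2] by (auto simp: power_one_over inverse_eq_divide)
    \<comment> \<open>One half of this gap absorbs the error of the approximation, the other is the
      margin demanded by the test.\<close>
    then have k: "2 / 2 ^ k < ?d" by (simp add: field_simps)
    have "real_of_rat (G (\<tau>1 (f x)) (\<tau>1 (g x)) k) > 1 / 2 ^ k + rad (f x) + rad (g x)"
      using G(2)[of "\<tau>1 (f x)" "\<tau>1 (g x)" k] k by (simp add: abs_less_iff)
    also have "1 / 2 ^ k + rad (f x) + rad (g x) = real_of_rat (1 / 2 ^ k + q (\<tau>2 (f x)) + q (\<tau>2 (g x)))"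
      by (simp add: of_rat_add of_rat_divide of_rat_power)
    finally have *: "1 / 2 ^ k + rat_of_code (?a x) + rat_of_code (?b x) < rat_of_code (?c x k)"
      by (simp add: of_rat_less hG hq(2))
    have pos: "rat_of_code (?a x) > 0" "rat_of_code (?b x) > 0" using q_pos by (simp_all flip: hq(2))
    have "(1 / 2 ^ k :: rat) > 0" by simp
    with * pos have "rat_of_code (?c x k) > 0" by linarith
    with pos obtain u v y where uvy: "pfst (?a x) = u + u" "pfst (?b x) = v + v" "pfst (?c x k) = y + y"
      by (metis rat_of_code_pos)
    show "?R x"
      using uvy *[unfolded rat_code_inequality[OF uvy]] by blast
  next
    assume "?R x"
    then obtain k u v y where uvy: "pfst (?a x) = u + u" "pfst (?b x) = v + v" "pfst (?c x k) = y + y"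
      and l: "Suc (psnd (?c x k)) * (Suc (psnd (?a x)) * Suc (psnd (?b x)) + 2 ^ k * (u * Suc (psnd (?b x)) + v * Suc (psnd (?a x))))
      < y * 2 ^ k * Suc (psnd (?a x)) * Suc (psnd (?b x))" by blast
    have "1 / 2 ^ k + q (\<tau>2 (f x)) + q (\<tau>2 (g x)) < G (\<tau>1 (f x)) (\<tau>1 (g x)) k"
      using l unfolding rat_code_inequality[OF uvy, symmetric] hG hq(2) .
    then have "real_of_rat (1 / 2 ^ k + q (\<tau>2 (f x)) + q (\<tau>2 (g x))) < real_of_rat (G (\<tau>1 (f x)) (\<tau>1 (g x)) k)"
      by (simp only: of_rat_less)
    then have "1 / 2 ^ k + rad (f x) + rad (g x) < real_of_rat (G (\<tau>1 (f x)) (\<tau>1 (g x)) k)"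
      by (simp add: of_rat_add of_rat_divide of_rat_power)
    then show "formally_disjoint (f x) (g x)"
      using G(2)[of "\<tau>1 (f x)" "\<tau>1 (g x)" k] unfolding formally_disjoint_def by (simp add: abs_less_iff)
  qed
  moreover have "semidecidable ?R"
    by (intro semidecidable_ex semidecidable_decidable decidable_conj decidable_eq decidable_less
        computable1_compose[OF h(1)] computable1_compose[OF hq(1)] computable1_compose[OF f] computable1_compose[OF g]
        computable1_power2 computable_intros)
  ultimately show ?thesis by simp
qed

lemma formally_disjoint_imp_disjoint: "formally_disjoint i j \<Longrightarrow> I i \<inter> I j = {}"
  unfolding formally_disjoint_def ballI_def by (intro disjoint_ballI) simp

text \<open>Each centre is within \<epsilon> of its point, so the centres are more than 2 \<epsilon>
  apart, which exceeds the sum of the radii. This is the origin of the factor 4.\<close>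

lemma formally_disjoint_small:
  assumes "rad i < \<epsilon>" "rad j < \<epsilon>" "x \<in> I i" "y \<in> I j" "4 * \<epsilon> \<le> dist x y"
  shows "formally_disjoint i j"
proof -
  have "dist x y \<le> dist (cen i) x + dist (cen i) (cen j) + dist (cen j) y"
    using dist_triangle[of x y "cen i"] dist_triangle[of "cen i" y "cen j"] by (simp add: dist_commute)
  then show ?thesis using assms unfolding formally_disjoint_def ballI_def by simp
qed

lemma small_ball_at:
  assumes "0 < \<epsilon>"
  shows "\<exists>l. x \<in> I l \<and> rad l < \<epsilon>"
proof -
  obtain r :: rat where r: "0 < r" "real_of_rat r < \<epsilon>"
    using of_rat_dense[OF assms] by (auto simp: zero_less_of_rat_iff)
  have "x \<in> closure (range \<alpha>)" "real_of_rat r > 0"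
    using cms r(1) unfolding computable_metric_space_def by simp_all
  then obtain a where a: "dist (\<alpha> a) x < real_of_rat r"
    unfolding closure_approachable by blast
  have "r \<in> range q" using r(1) enum unfolding enum_data_def by simp
  then obtain b where b: "q b = r" by blast
  have "(a, b) \<in> range (\<lambda>i. (\<tau>1 i, \<tau>2 i))" using enum unfolding enum_data_def by simp
  then obtain i where "\<tau>1 i = a" "\<tau>2 i = b" by blast
  then show ?thesis using a b r(2) unfolding ballI_def by auto
qed

text \<open>The balls are required to meet \<open>K\<close> so that each supplies a point of
  \<open>K\<close> to which \<open>formally_disjoint_small\<close> can be applied.\<close>

lemma fine_cover:
  assumes "compact K" "0 < \<epsilon>"
  shows "\<exists>A. finite A \<and> K \<subseteq> (\<Union>l\<in>A. I l) \<and> (\<forall>l\<in>A. rad l < \<epsilon> \<and> K \<inter> I l \<noteq> {})"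
proof -
  have "K \<subseteq> (\<Union>l\<in>{l. rad l < \<epsilon> \<and> K \<inter> I l \<noteq> {}}. I l)"
    using small_ball_at[OF assms(2)] by blast
  then obtain A where A: "A \<subseteq> {l. rad l < \<epsilon> \<and> K \<inter> I l \<noteq> {}}" "finite A" "K \<subseteq> (\<Union>l\<in>A. I l)"
    by (rule compactE_image[OF assms(1) open_I])
  then show ?thesis by blast
qed

end

section \<open>Covers of the cube and charts\<close>

text \<open>As in \<open>Euclidean_space\<close>, a point of n-space is a sequence vanishing from
  index \<open>n\<close> on.\<close>

definition box_fun :: "nat \<Rightarrow> (nat \<Rightarrow> real) \<Rightarrow> (nat \<Rightarrow> real) \<Rightarrow> (nat \<Rightarrow> real) set" where
  "box_fun n a b = {y. (\<forall>i<n. a i \<le> y i \<and> y i \<le> b i) \<and> (\<forall>i\<ge>n. y i = 0)}"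

lemma tendsto_fun_coordinatewise:
  fixes f :: "'b \<Rightarrow> nat \<Rightarrow> real"
  assumes "\<And>i. ((\<lambda>t. f t i) \<longlongrightarrow> l i) F"
  shows "(f \<longlongrightarrow> l) F"
proof -
  have "limitin (product_topology (\<lambda>i. euclidean) UNIV) f l F"
    unfolding limitin_componentwise using assms by simp
  then show ?thesis by (simp add: euclidean_product_topology)
qed

lemma tendsto_fun_coordinate:
  fixes f :: "'b \<Rightarrow> nat \<Rightarrow> real"
  assumes "(f \<longlongrightarrow> l) F"
  shows "((\<lambda>t. f t i) \<longlongrightarrow> l i) F"
proof -
  have "limitin (product_topology (\<lambda>i. euclidean) UNIV) f l F"
    using assms by (simp add: euclidean_product_topology)
  then show ?thesis unfolding limitin_componentwise by simp
qed

lemma compact_box_fun: "compact (box_fun n a b)"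
proof -
  have "box_fun n a b = PiE UNIV (\<lambda>i. if i < n then {a i..b i} else {0})"
    unfolding box_fun_def by (auto simp: PiE_iff split: if_splits)
  moreover have "compactin (product_topology (\<lambda>i. euclidean) UNIV) (PiE UNIV (\<lambda>i. if i < n then {a i..b i} else {0}))"
    unfolding compactin_PiE by auto
  ultimately show ?thesis by (simp add: euclidean_product_topology)
qed

text \<open>A basic open set of the product restricts each coordinate separately. From index
  \<open>n\<close> on, points of the box agree with \<open>c\<close>, so only \<open>n\<close>
  restrictions remain and one \<delta> meets them all.\<close>

lemma open_box_fun_nbhd:
  fixes c :: "nat \<Rightarrow> real"
  assumes "open W" "c \<in> W" "\<forall>i\<ge>n. c i = 0"
  obtains \<delta> where "0 < \<delta>" "box_fun n (\<lambda>i. c i - \<delta>) (\<lambda>i. c i + \<delta>) \<subseteq> W"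
proof -
  have "openin (product_topology (\<lambda>i. euclidean) UNIV) W"
    using assms(1) by (simp add: open_fun_def)
  then obtain X where X: "c \<in> PiE UNIV X" "\<And>i. open (X i)" "PiE UNIV X \<subseteq> W"
    using product_topology_open_contains_basis[OF _ assms(2)] by (metis open_openin)
  have "\<forall>\<^sub>F \<delta> in at_right 0. \<forall>i\<in>{..<n}. {c i - \<delta>..c i + \<delta>} \<subseteq> X i"
  proof (rule eventually_ball_finite)
    show "\<forall>i\<in>{..<n}. \<forall>\<^sub>F \<delta> in at_right 0. {c i - \<delta>..c i + \<delta>} \<subseteq> X i"
    proof
      fix i
      have "c i \<in> X i" using X(1) by auto
      then obtain e where e: "0 < e" "cball (c i) e \<subseteq> X i" using X(2) open_contains_cball by blast
      show "\<forall>\<^sub>F \<delta> in at_right 0. {c i - \<delta>..c i + \<delta>} \<subseteq> X i"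
        unfolding eventually_at_right_field
      proof (intro exI[of _ e] conjI allI impI)
        fix y :: real assume "y > 0" "y < e"
        then show "{c i - y..c i + y} \<subseteq> X i" using e(2) by (auto simp: cball_def dist_real_def subset_iff)
      qed (use e in auto)
    qed
  qed simp
  then have "\<forall>\<^sub>F \<delta> in at_right 0. 0 < \<delta> \<and> (\<forall>i\<in>{..<n}. {c i - \<delta>..c i + \<delta>} \<subseteq> X i)"
    using eventually_at_right_less[of "0::real"] by eventually_elim simp
  then have "\<exists>\<delta>. 0 < \<delta> \<and> (\<forall>i\<in>{..<n}. {c i - \<delta>..c i + \<delta>} \<subseteq> X i)"
    by (rule eventually_happens'[OF trivial_limit_at_right_real])
  then obtain \<delta> where \<delta>0: "0 < \<delta> \<and> (\<forall>i\<in>{..<n}. {c i - \<delta>..c i + \<delta>} \<subseteq> X i)" ..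
  then have \<delta>: "0 < \<delta>" by (rule conjunct1)
  have \<delta>X: "{c i - \<delta>..c i + \<delta>} \<subseteq> X i" if "i < n" for i
    by (rule bspec[OF conjunct2[OF \<delta>0]]) (simp add: that)
  have "y \<in> W" if y: "y \<in> box_fun n (\<lambda>i. c i - \<delta>) (\<lambda>i. c i + \<delta>)" for y
  proof -
    have "y i \<in> X i" for i
    proof (cases "i < n")
      case True
      have "y i \<in> {c i - \<delta>..c i + \<delta>}" using y True unfolding box_fun_def by auto
      then show ?thesis using \<delta>X[OF True] by blast
    next
      case False
      then have "y i = c i" using y assms(3) unfolding box_fun_def by simp
      moreover have "c i \<in> X i" using X(1) by auto
      ultimately show ?thesis by simp
    qed
    then have "y \<in> PiE UNIV X" by auto
    then show ?thesis using X(3) by blast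
  qed
  then show ?thesis using that[OF \<delta>] by blast
qed

text \<open>The \<open>k\<close>-th label of a grid point records whether the point lies in \<open>A k\<close>. Kuhn's lemma yields
  arbitrarily small grid cells on which every label takes both values, so that an accumulation
  point of such cells can lie in none of the open sets.\<close>

lemma cube_not_covered:
  fixes A B :: "nat \<Rightarrow> (nat \<Rightarrow> real) set" and n :: nat
  defines "Q \<equiv> box_fun n (\<lambda>_. 0) (\<lambda>_. 1)"
  assumes opA: "\<And>k. k < n \<Longrightarrow> openin (top_of_set Q) (A k)" and opB: "\<And>k. k < n \<Longrightarrow> openin (top_of_set Q) (B k)"
    and disj: "\<And>k. k < n \<Longrightarrow> A k \<inter> B k = {}"
    and faceA: "\<And>k u. k < n \<Longrightarrow> u \<in> A k \<Longrightarrow> u k \<noteq> 0" and faceB: "\<And>k u. k < n \<Longrightarrow> u \<in> B k \<Longrightarrow> u k \<noteq> 1"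
  shows "\<not> Q \<subseteq> (\<Union>k<n. A k \<union> B k)"
proof
  assume cover: "Q \<subseteq> (\<Union>k<n. A k \<union> B k)"
  define pt where "pt p x = (\<lambda>i. if i < n then real (x i) / real p else 0)" for p and x :: "nat \<Rightarrow> nat"
  \<comment> \<open>The clause \<open>x k = p\<close> gives the upper face the label 1 that Kuhn's
    lemma demands. Points of \<open>B k\<close> avoid that face, so they still have label 0.\<close>
  define label where "label p x k = (if pt p x \<in> A k \<or> x k = p then 1 else 0 :: nat)" for p x k
  define adj where "adj z x \<longleftrightarrow> (\<forall>j<n. z j \<le> x j \<and> x j \<le> z j + (1::nat))" for z x
  define sep where "sep p z k r s \<longleftrightarrow> adj z r \<and> adj z s \<and> label p r k \<noteq> label p s k" for p z k r s
  have ex: "\<exists>z. (\<forall>i<n. z i < p) \<and> (\<forall>k<n. \<exists>r s. sep p z k r s)" if "0 < p" for p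
  proof -
    have "label p x i = 0" if "i < n" "x i = 0" for x i
      using faceA[OF that(1), of "pt p x"] that \<open>0 < p\<close> unfolding label_def pt_def by auto
    then have L0: "\<forall>x. (\<forall>i<n. x i \<le> p) \<longrightarrow> (\<forall>i<n. x i = 0 \<longrightarrow> label p x i = 0)" by simp
    have L1: "\<forall>x. (\<forall>i<n. x i \<le> p) \<longrightarrow> (\<forall>i<n. x i = p \<longrightarrow> label p x i = 1)"
      unfolding label_def by auto
    have L: "\<forall>x. (\<forall>i<n. x i \<le> p) \<longrightarrow> (\<forall>i<n. label p x i = 0 \<or> label p x i = 1)"
      unfolding label_def by auto
    show ?thesis
    proof (rule kuhn_lemma[OF that L L0 L1], fold adj_def, fold sep_def)
      fix z assume "\<forall>i<n. z i < p" "\<forall>k<n. \<exists>r s. sep p z k r s"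
      then show ?thesis by (intro exI[of _ z] conjI)
    qed
  qed
  define z where "z p = (SOME z. (\<forall>i<n. z i < p) \<and> (\<forall>k<n. \<exists>r s. sep p z k r s))" for p
  have z0: "(\<forall>i<n. z p i < p) \<and> (\<forall>k<n. \<exists>r s. sep p (z p) k r s)" if "0 < p" for p
    unfolding z_def by (rule someI_ex[OF ex[OF that]])
  define w where "w p k = (SOME w. sep p (z p) k (fst w) (snd w))" for p k
  define r s where "r p k = fst (w p k)" and "s p k = snd (w p k)" for p k
  have sep: "sep p (z p) k (r p k) (s p k)" if p: "0 < p" and k: "k < n" for p k
  proof -
    obtain x y where "sep p (z p) k x y" using z0[OF p] k by blast
    then have "\<exists>w. sep p (z p) k (fst w) (snd w)" by (intro exI[of _ "(x, y)"]) simp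
    then show ?thesis unfolding r_def s_def w_def by (rule someI_ex)
  qed
  have r: "z p j \<le> r p k j \<and> r p k j \<le> z p j + 1" and s: "z p j \<le> s p k j \<and> s p k j \<le> z p j + 1"
    if "0 < p" "k < n" "j < n" for p k j
    using sep[OF that(1,2)] that(3) unfolding sep_def adj_def by blast+
  have rs: "label p (r p k) k \<noteq> label p (s p k) k" if "0 < p" "k < n" for p k
    using sep[OF that] unfolding sep_def by blast
  have z: "z p i < p" if "0 < p" "i < n" for p i using z0[OF that(1)] that(2) by blast
  have inQ: "pt p x \<in> Q" if "0 < p" "\<And>i. i < n \<Longrightarrow> x i \<le> p" for p x
    using that unfolding pt_def Q_def box_fun_def by auto
  \<comment> \<open>The successor keeps the number of subdivisions positive.\<close>
  define \<zeta> where "\<zeta> m = pt (Suc m) (z (Suc m))" for m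
  have \<zeta>Q: "\<forall>m. \<zeta> m \<in> Q" unfolding \<zeta>_def using z by (intro allI inQ) (auto intro: less_imp_le)
  have "seq_compact Q" unfolding Q_def by (intro compact_imp_seq_compact compact_box_fun)
  from this[unfolded seq_compact_def, THEN spec[of _ \<zeta>], THEN mp, OF \<zeta>Q]
  obtain l and \<phi> :: "nat \<Rightarrow> nat" where l: "l \<in> Q" "strict_mono \<phi>" and lim: "(\<zeta> \<circ> \<phi>) \<longlonglongrightarrow> l" by blast
  \<comment> \<open>Any choice of corners from the chosen cells has the same limit, because the side
    of a cell tends to 0.\<close>
  have near: "(\<lambda>m. pt (Suc (\<phi> m)) (x (Suc (\<phi> m)))) \<longlonglongrightarrow> l"
    if x: "\<And>p j. 0 < p \<Longrightarrow> j < n \<Longrightarrow> z p j \<le> x p j \<and> x p j \<le> z p j + 1" for x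
  proof (rule tendsto_fun_coordinatewise)
    fix i
    show "(\<lambda>m. pt (Suc (\<phi> m)) (x (Suc (\<phi> m))) i) \<longlonglongrightarrow> l i"
    proof (cases "i < n")
      case True
      have 1: "(\<lambda>m. pt (Suc (\<phi> m)) (z (Suc (\<phi> m))) i) \<longlonglongrightarrow> l i"
        using tendsto_fun_coordinate[OF lim, of i] by (simp add: comp_def \<zeta>_def)
      have "(\<lambda>m. 1 / real (Suc (\<phi> m))) \<longlonglongrightarrow> 0"
        using LIMSEQ_subseq_LIMSEQ[OF lim_1_over_n[THEN LIMSEQ_Suc] l(2)] by (simp add: comp_def)
      from tendsto_add[OF 1 this]
      have 2: "(\<lambda>m. pt (Suc (\<phi> m)) (z (Suc (\<phi> m))) i + 1 / real (Suc (\<phi> m))) \<longlonglongrightarrow> l i" by simp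
      have b: "pt p (z p) i \<le> pt p (x p) i \<and> pt p (x p) i \<le> pt p (z p) i + 1 / real p" if "0 < p" for p
      proof -
        have "real (z p i) \<le> real (x p i)" "real (x p i) \<le> real (z p i) + 1"
          using x[OF that True] by linarith+
        then show ?thesis using True that unfolding pt_def
          by (auto simp: divide_right_mono add_divide_distrib[symmetric])
      qed
      show ?thesis
        by (rule tendsto_sandwich[OF always_eventually always_eventually 1 2]) (use b in \<open>simp_all del: of_nat_Suc\<close>)
    next
      case False
      have "l i = 0" using l(1) False unfolding Q_def box_fun_def by simp
      then show ?thesis using False unfolding pt_def by simp
    qed
  qed
  obtain k where k: "k < n" "l \<in> A k \<or> l \<in> B k" using cover l(1) by blast
  have inQ': "pt p (x p) \<in> Q" if "\<And>j. j < n \<Longrightarrow> z p j \<le> x p j \<and> x p j \<le> z p j + 1" "0 < p" for p x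
    by (rule inQ[OF that(2)]) (use that(1) z[OF that(2)] in fastforce)
  have ev: "\<forall>\<^sub>F m in sequentially. pt (Suc (\<phi> m)) (x (Suc (\<phi> m))) \<in> W"
    if "openin (top_of_set Q) W" "l \<in> W" and x: "\<And>p j. 0 < p \<Longrightarrow> j < n \<Longrightarrow> z p j \<le> x p j \<and> x p j \<le> z p j + 1" for x W
  proof -
    obtain O' where O': "open O'" "W = Q \<inter> O'" using \<open>openin (top_of_set Q) W\<close> openin_open by blast
    have "\<forall>\<^sub>F m in sequentially. pt (Suc (\<phi> m)) (x (Suc (\<phi> m))) \<in> O'"
      using topological_tendstoD[OF near[OF x] O'(1)] that(2) O'(2) by blast
    then show ?thesis
    proof eventually_elim
      case (elim m)
      then show ?case using inQ'[of "Suc (\<phi> m)" x] x O'(2) by simp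
    qed
  qed
  have "\<exists>W. (W = A k \<or> W = B k) \<and> l \<in> W" using k(2) by blast
  then obtain W where W: "W = A k \<or> W = B k" "l \<in> W" by blast
  have opW: "openin (top_of_set Q) W" using W(1) opA[OF k(1)] opB[OF k(1)] by blast
  \<comment> \<open>In late cells the two corners whose \<open>k\<close>-th labels differ both lie
    in the open set \<open>W\<close>, on which that label is constant.\<close>
  have "\<forall>\<^sub>F m in sequentially. pt (Suc (\<phi> m)) (r (Suc (\<phi> m)) k) \<in> W \<and> pt (Suc (\<phi> m)) (s (Suc (\<phi> m)) k) \<in> W"
    using ev[OF opW W(2), of "\<lambda>p. r p k"] ev[OF opW W(2), of "\<lambda>p. s p k"] r[OF _ k(1)] s[OF _ k(1)]
    by (simp add: eventually_conj_iff)
  then obtain m where m: "pt (Suc (\<phi> m)) (r (Suc (\<phi> m)) k) \<in> W" "pt (Suc (\<phi> m)) (s (Suc (\<phi> m)) k) \<in> W"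
    unfolding eventually_sequentially by blast
  have lab: "label (Suc (\<phi> m)) x k = (if W = A k then 1 else 0)" if "pt (Suc (\<phi> m)) x \<in> W" for x
  proof (cases "W = A k")
    case True then show ?thesis using that unfolding label_def by simp
  next
    case False
    then have "pt (Suc (\<phi> m)) x \<in> B k" using W(1) that by simp
    then have "pt (Suc (\<phi> m)) x \<notin> A k" "x k \<noteq> Suc (\<phi> m)"
      using disj[OF k(1)] faceB[OF k(1), of "pt (Suc (\<phi> m)) x"] k(1) unfolding pt_def by auto
    then show ?thesis using False unfolding label_def by simp
  qed
  show False using rs[of "Suc (\<phi> m)" k] k(1) lab[OF m(1)] lab[OF m(2)] by simp
qed

section \<open>Charts into the half-space and the manifold boundary\<close>

definition half_fun :: "nat \<Rightarrow> (nat \<Rightarrow> real) set" where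
  "half_fun n = {y. (\<forall>i\<ge>n. y i = 0) \<and> 0 \<le> y (n - 1)}"

definition chart :: "'a::metric_space set \<Rightarrow> nat \<Rightarrow> 'a set \<Rightarrow> (nat \<Rightarrow> real) set \<Rightarrow> ('a \<Rightarrow> nat \<Rightarrow> real)
    \<Rightarrow> ((nat \<Rightarrow> real) \<Rightarrow> 'a) \<Rightarrow> bool" where
  "chart S n U V f g \<longleftrightarrow> openin (top_of_set S) U \<and> openin (top_of_set (half_fun n)) V \<and> homeomorphism U V f g"

lemma Euclidean_space_eq: "Euclidean_space n = top_of_set {y. \<forall>i\<ge>n. y i = 0}"
  unfolding Euclidean_space_def by (simp add: euclidean_product_topology)

lemma halfspace_eq: "halfspace n = top_of_set (half_fun n)"
proof -
  have "{y. \<forall>i\<ge>n. y i = 0} \<inter> {x. x (n - 1) \<ge> 0} = half_fun n" unfolding half_fun_def by auto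
  then show ?thesis unfolding halfspace_def Euclidean_space_eq by (simp add: subtopology_subtopology)
qed

lemma homeomorphic_map_iff_homeomorphism:
  fixes U :: "'a::topological_space set" and V :: "'b::topological_space set"
  shows "homeomorphic_map (top_of_set U) (top_of_set V) f \<longleftrightarrow> (\<exists>g. homeomorphism U V f g)"
proof
  assume "homeomorphic_map (top_of_set U) (top_of_set V) f"
  then obtain g where "homeomorphic_maps (top_of_set U) (top_of_set V) f g"
    unfolding homeomorphic_map_maps by blast
  then have "homeomorphism U V f g"
    unfolding homeomorphic_maps_def continuous_map_subtopology_eu
    by (intro homeomorphismI) auto
  then show "\<exists>g. homeomorphism U V f g" by blast
next
  assume "\<exists>g. homeomorphism U V f g"
  then obtain g where "homeomorphism U V f g" ..
  then have "homeomorphic_maps (top_of_set U) (top_of_set V) f g"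
    unfolding homeomorphic_maps_def continuous_map_subtopology_eu homeomorphism_def by auto
  then show "homeomorphic_map (top_of_set U) (top_of_set V) f"
    unfolding homeomorphic_map_maps by blast
qed

text \<open>Passes from maps between abstract topologies to homeomorphisms of sets with a named
  inverse, the form in which all later arguments are carried out.\<close>

lemma ex_chart_iff:
  "(openin (top_of_set S) U \<and> openin (halfspace n) V \<and>
     homeomorphic_map (subtopology (top_of_set S) U) (subtopology (halfspace n) V) f) \<longleftrightarrow> (\<exists>g. chart S n U V f g)"
proof -
  have "S \<inter> U = U" if "openin (top_of_set S) U" using openin_imp_subset[OF that] by blast
  moreover have "half_fun n \<inter> V = V" if "openin (top_of_set (half_fun n)) V"
    using openin_imp_subset[OF that] by blast
  ultimately show ?thesis
    unfolding chart_def halfspace_eq subtopology_subtopology homeomorphic_map_iff_homeomorphism[symmetric]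
    by (auto simp: homeomorphic_map_iff_homeomorphism)
qed

lemma manifold_with_boundary_chart:
  assumes "manifold_with_boundary n (top_of_set S)" "x \<in> S"
  obtains U V f g where "chart S n U V f g" "x \<in> U"
proof -
  have "\<exists>U V f. openin (top_of_set S) U \<and> x \<in> U \<and> openin (halfspace n) V \<and>
     homeomorphic_map (subtopology (top_of_set S) U) (subtopology (halfspace n) V) f"
    using assms unfolding manifold_with_boundary_def by auto
  then show ?thesis using that ex_chart_iff by blast
qed

lemma mem_manifold_boundary_iff:
  "x \<in> manifold_boundary n (top_of_set S) \<longleftrightarrow> (\<exists>U V f g. chart S n U V f g \<and> x \<in> U \<and> f x (n - 1) = 0)"
proof -
  have "x \<in> manifold_boundary n (top_of_set S) \<longleftrightarrow> x \<in> S \<and> (\<exists>U V f. (\<exists>g. chart S n U V f g) \<and> x \<in> U \<and> f x (n - 1) = 0)"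
    unfolding manifold_boundary_def ex_chart_iff[symmetric] by auto
  moreover have "x \<in> S" if "chart S n U V f g" "x \<in> U" for U V f g
    using that openin_imp_subset unfolding chart_def by blast
  ultimately show ?thesis by blast
qed

lemma open_coordinate_gt: "open {y :: nat \<Rightarrow> real. a < y i}"
  by (intro open_Collect_less continuous_on_const continuous_on_product_coordinates)

lemma open_coordinate_lt: "open {y :: nat \<Rightarrow> real. y i < a}"
  by (intro open_Collect_less continuous_on_const continuous_on_product_coordinates)

text \<open>Being a boundary point is witnessed by one chart; here it is transferred to every chart.
  Otherwise the transition map \<open>f'\<close> after \<open>g\<close> would carry an open subset
  of n-space injectively into the half-space and hit its bounding hyperplane, although by invariance
  of domain the image is open.\<close>

lemma boundary_last_coordinate:
  assumes n: "n \<ge> 1" and ch: "chart S n U V f g" and z: "z \<in> U" and b: "z \<in> manifold_boundary n (top_of_set S)"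
  shows "f z (n - 1) = 0"
proof (rule ccontr)
  assume "f z (n - 1) \<noteq> 0"
  obtain U' V' f' g' where ch': "chart S n U' V' f' g'" and z': "z \<in> U'" "f' z (n - 1) = 0"
    using b unfolding mem_manifold_boundary_iff by blast
  have hom: "homeomorphism U V f g" and hom': "homeomorphism U' V' f' g'"
    and opU: "openin (top_of_set S) U" "openin (top_of_set S) U'"
    and V: "openin (top_of_set (half_fun n)) V" and V': "V' \<subseteq> half_fun n"
    using ch ch' openin_imp_subset unfolding chart_def by blast+
  define E :: "(nat \<Rightarrow> real) set" where "E = {y. \<forall>i\<ge>n. y i = 0}"
  have "openin (top_of_set U) (U \<inter> U')"
    using opU by (metis inf.commute inf_le1 openin_Int openin_imp_subset openin_subset_trans)
  then have "openin (top_of_set V) (f ` (U \<inter> U'))" by (rule homeomorphism_imp_open_map[OF hom])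
  then have "openin (top_of_set (half_fun n)) (f ` (U \<inter> U'))" using V by (rule openin_trans)
  then obtain W where W: "open W" "f ` (U \<inter> U') = half_fun n \<inter> W" unfolding openin_open by blast
  \<comment> \<open>Positivity of the last coordinate makes \<open>B\<close> open in n-space and not
    merely in the half-space.\<close>
  define B where "B = E \<inter> (W \<inter> {y. 0 < y (n - 1)})"
  have BW: "B \<subseteq> f ` (U \<inter> U')" unfolding B_def E_def W(2) half_fun_def by auto
  have "f z \<in> half_fun n" using W(2) z z'(1) by blast
  then have zB: "f z \<in> B" using \<open>f z (n - 1) \<noteq> 0\<close> W(2) z z'(1) unfolding B_def E_def half_fun_def by auto
  have gB: "g y \<in> U \<inter> U'" "f (g y) = y" if "y \<in> B" for y
    using that BW hom unfolding homeomorphism_def by force+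
  let ?h = "\<lambda>y. f' (g y)"
  have "f' ` U' = V'" using hom' unfolding homeomorphism_def by blast
  then have "?h y \<in> half_fun n" if "y \<in> B" for y using gB(1)[OF that] V' by blast
  then have hB: "?h ` B \<subseteq> half_fun n" by blast
  have "openin (top_of_set E) B"
    unfolding B_def using W(1) by (intro openin_open_Int open_Int open_coordinate_gt)
  moreover have "continuous_on B ?h"
  proof (rule continuous_on_compose2[of U'])
    show "continuous_on U' f'" using hom' unfolding homeomorphism_def by blast
    have "B \<subseteq> V" using BW hom unfolding homeomorphism_def by blast
    moreover have "continuous_on V g" using hom unfolding homeomorphism_def by blast
    ultimately show "continuous_on B g" using continuous_on_subset by metis
  qed (use gB(1) in blast)
  moreover have "inj_on ?h B"
  proof (rule inj_onI)
    fix x y assume xy: "x \<in> B" "y \<in> B" "?h x = ?h y"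
    then have "g' (?h x) = g' (?h y)" by simp
    then have "g x = g y" using gB(1)[OF xy(1)] gB(1)[OF xy(2)] hom' unfolding homeomorphism_def by simp
    then show "x = y" using gB(2)[OF xy(1)] gB(2)[OF xy(2)] by metis
  qed
  moreover have "half_fun n \<subseteq> E" unfolding half_fun_def E_def by blast
  moreover have "B \<subseteq> E" unfolding B_def by blast
  ultimately have "openin (top_of_set E) (?h ` B)"
    using invariance_of_domain_Euclidean_space[of n B ?h] hB
    unfolding Euclidean_space_eq E_def[symmetric]
    by (simp add: subtopology_subtopology Int_absorb1 Int_absorb2 image_subset_iff continuous_map_subtopology_eu Pi_iff subset_iff)
  then obtain T where T: "open T" "?h ` B = E \<inter> T" unfolding openin_open by blast
  have p: "f' z \<in> ?h ` B"
    using zB z hom unfolding homeomorphism_def by (metis image_eqI)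
  then have "f' z \<in> T" "\<forall>i\<ge>n. f' z i = 0" unfolding T(2) E_def by auto
  then obtain \<delta> where \<delta>: "0 < \<delta>" "box_fun n (\<lambda>i. f' z i - \<delta>) (\<lambda>i. f' z i + \<delta>) \<subseteq> T"
    using open_box_fun_nbhd[OF T(1)] by blast
  \<comment> \<open>Pushing \<open>f' z\<close> down by \<delta> stays in the open image but leaves
    the half-space.\<close>
  define y where "y = (f' z)(n - 1 := - \<delta>)"
  have "y \<in> box_fun n (\<lambda>i. f' z i - \<delta>) (\<lambda>i. f' z i + \<delta>)"
    using \<delta>(1) z'(2) \<open>\<forall>i\<ge>n. f' z i = 0\<close> n unfolding y_def box_fun_def by auto
  moreover have "y \<in> E" using \<open>\<forall>i\<ge>n. f' z i = 0\<close> n unfolding y_def E_def by auto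
  ultimately have "y \<in> half_fun n" using \<delta>(2) T(2) hB by blast
  then show False using \<delta>(1) unfolding y_def half_fun_def by simp
qed

lemma ex_chart_box:
  assumes "chart S n U V f g" "x \<in> U"
  obtains \<delta> where "0 < \<delta>" "box_fun n (\<lambda>i. f x i - 3 * \<delta>) (\<lambda>i. f x i + 3 * \<delta>) \<inter> half_fun n \<subseteq> V"
proof -
  obtain W where W: "open W" "V = half_fun n \<inter> W" using assms(1) unfolding chart_def openin_open by blast
  have "f x \<in> V" using assms unfolding chart_def homeomorphism_def by blast
  then have "f x \<in> W" "\<forall>i\<ge>n. f x i = 0" using W(2) unfolding half_fun_def by auto
  then obtain e where e: "0 < e" "box_fun n (\<lambda>i. f x i - e) (\<lambda>i. f x i + e) \<subseteq> W"
    using open_box_fun_nbhd[OF W(1)] by blast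
  show ?thesis by (rule that[of "e / 3"]) (use e W(2) in auto)
qed

section \<open>Geometry of a fixed box in a chart\<close>

locale chart_box =
  fixes S :: "'a::metric_space set" and n :: nat and U V f g x and \<delta> :: real
  assumes n: "n \<ge> 1" and S: "compact S" and chart: "chart S n U V f g" and x: "x \<in> U" and \<delta>: "0 < \<delta>"
    and box: "box_fun n (\<lambda>i. f x i - 3 * \<delta>) (\<lambda>i. f x i + 3 * \<delta>) \<inter> half_fun n \<subseteq> V"
begin

abbreviation T :: "'a set" where "T \<equiv> manifold_boundary n (top_of_set S)"
definition c :: "nat \<Rightarrow> real" where "c = f x"
text \<open>Three radii occur. \<open>N \<delta>\<close> is where balls are to be detected,
  \<open>D (2 * \<delta>)\<close> is the cube on which the topological contradiction takes place,
  and the complement of \<open>N (3 * \<delta>)\<close> is covered once and for all.\<close>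

definition D :: "real \<Rightarrow> 'a set" where "D r = {z \<in> U. \<forall>i<n. \<bar>f z i - c i\<bar> \<le> r}"
definition N :: "real \<Rightarrow> 'a set" where "N r = {z \<in> U. \<forall>i<n. \<bar>f z i - c i\<bar> < r}"
definition lower_face :: "nat \<Rightarrow> 'a set" where "lower_face k = {z \<in> D (2 * \<delta>). f z k = c k - 2 * \<delta>}"
definition upper_face :: "nat \<Rightarrow> 'a set" where "upper_face k = {z \<in> D (2 * \<delta>). f z k = c k + 2 * \<delta>}"
text \<open>The two parts overlap: they are not the pieces of a cover but fixed containers for them.
  Pieces cut near any point of \<open>N \<delta>\<close> fit inside, so precautions taken for the
  containers serve every ball.\<close>

definition lower_part :: "nat \<Rightarrow> 'a set" where "lower_part k = {z \<in> D (3 * \<delta>). f z k \<le> c k + \<delta>}"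
definition upper_part :: "nat \<Rightarrow> 'a set" where "upper_part k = {z \<in> D (3 * \<delta>). c k - \<delta> \<le> f z k}"

lemma hom: "homeomorphism U V f g" and open_U: "openin (top_of_set S) U"
  and open_V: "openin (top_of_set (half_fun n)) V" and US: "U \<subseteq> S" and VH: "V \<subseteq> half_fun n"
  using chart openin_imp_subset unfolding chart_def by blast+

lemma f_V: "z \<in> U \<Longrightarrow> f z \<in> V" and g_U: "y \<in> V \<Longrightarrow> g y \<in> U"
  and gf: "z \<in> U \<Longrightarrow> g (f z) = z" and fg: "y \<in> V \<Longrightarrow> f (g y) = y"
  and cont_f: "continuous_on U f" and cont_g: "continuous_on V g"
  using hom unfolding homeomorphism_def by blast+

text \<open>Transports compactness from the box to \<open>S\<close>. It works up to radius 3
  \<delta>, for which the box within the half-space is known to lie in \<open>V\<close>.\<close>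

lemma D_eq:
  assumes "r \<le> 3 * \<delta>"
  shows "{z \<in> D r. f z \<in> F} = g ` (box_fun n (\<lambda>i. c i - r) (\<lambda>i. c i + r) \<inter> half_fun n \<inter> F)" (is "?L = g ` ?R")
    and "box_fun n (\<lambda>i. c i - r) (\<lambda>i. c i + r) \<inter> half_fun n \<subseteq> V"
proof -
  have "box_fun n (\<lambda>i. c i - r) (\<lambda>i. c i + r) \<subseteq> box_fun n (\<lambda>i. f x i - 3 * \<delta>) (\<lambda>i. f x i + 3 * \<delta>)"
    using assms unfolding box_fun_def c_def by force
  then show V: "box_fun n (\<lambda>i. c i - r) (\<lambda>i. c i + r) \<inter> half_fun n \<subseteq> V" using box by blast
  show "?L = g ` ?R"
  proof
    show "?L \<subseteq> g ` ?R"
    proof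
      fix z assume z: "z \<in> ?L"
      then have "z \<in> U" "\<And>i. i < n \<Longrightarrow> \<bar>f z i - c i\<bar> \<le> r" unfolding D_def by auto
      moreover from this have "f z \<in> half_fun n" using f_V VH by blast
      ultimately have "f z \<in> ?R" using z unfolding box_fun_def half_fun_def by (auto simp: abs_le_iff algebra_simps)
      then show "z \<in> g ` ?R" using gf[OF \<open>z \<in> U\<close>] by (metis image_eqI)
    qed
    show "g ` ?R \<subseteq> ?L"
    proof
      fix z assume "z \<in> g ` ?R"
      then obtain y where y: "y \<in> ?R" "z = g y" by blast
      then have "y \<in> V" using V by blast
      then show "z \<in> ?L" using y fg[of y] g_U[of y]
        unfolding D_def box_fun_def by (auto simp: abs_le_iff algebra_simps)
    qed
  qed
qed

lemma compact_D_closed: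
  assumes "r \<le> 3 * \<delta>" "closed F"
  shows "compact {z \<in> D r. f z \<in> F}"
proof -
  have "box_fun n (\<lambda>i. c i - r) (\<lambda>i. c i + r) \<inter> half_fun n \<inter> F
      = box_fun n (\<lambda>i. c i - r) (\<lambda>i. c i + r) \<inter> ({y. 0 \<le> y (n - 1)} \<inter> F)"
    unfolding box_fun_def half_fun_def by auto
  moreover have "closed ({y. 0 \<le> y (n - 1)} \<inter> F)"
    by (intro closed_Int closed_Collect_le continuous_on_const continuous_on_product_coordinates assms(2))
  ultimately have "compact (box_fun n (\<lambda>i. c i - r) (\<lambda>i. c i + r) \<inter> half_fun n \<inter> F)"
    using compact_Int_closed[OF compact_box_fun] by simp
  moreover have "continuous_on (box_fun n (\<lambda>i. c i - r) (\<lambda>i. c i + r) \<inter> half_fun n \<inter> F) g"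
    by (rule continuous_on_subset[OF cont_g]) (use D_eq(2)[OF assms(1)] in blast)
  ultimately show ?thesis unfolding D_eq(1)[OF assms(1)] using compact_continuous_image by blast
qed

lemma compact_D_ge: "r \<le> 3 * \<delta> \<Longrightarrow> compact {z \<in> D r. t \<le> f z k}"
  using compact_D_closed[of r "{y. t \<le> y k}"]
  by (simp add: closed_Collect_le continuous_on_const continuous_on_product_coordinates)

lemma compact_D_le: "r \<le> 3 * \<delta> \<Longrightarrow> compact {z \<in> D r. f z k \<le> t}"
  using compact_D_closed[of r "{y. y k \<le> t}"]
  by (simp add: closed_Collect_le continuous_on_const continuous_on_product_coordinates)

lemma compact_D_eq: "r \<le> 3 * \<delta> \<Longrightarrow> compact {z \<in> D r. f z k = t}"
  using compact_D_closed[of r "{y. y k = t}"]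
  by (simp add: closed_Collect_eq continuous_on_const continuous_on_product_coordinates)

lemma compact_D: "r \<le> 3 * \<delta> \<Longrightarrow> compact (D r)"
  using compact_D_closed[of r UNIV] by simp

lemma compact_parts: "compact (lower_face k)" "compact (upper_face k)" "compact (lower_part k)" "compact (upper_part k)"
  unfolding lower_face_def upper_face_def lower_part_def upper_part_def
  using \<delta> by (auto intro!: compact_D_eq compact_D_le compact_D_ge)

lemma disjoint_parts: "lower_face k \<inter> upper_part k = {}" "upper_face k \<inter> lower_part k = {}"
  unfolding lower_face_def upper_face_def lower_part_def upper_part_def using \<delta> by auto

lemma open_box: "open {y :: nat \<Rightarrow> real. \<forall>i<n. \<bar>y i - c i\<bar> < r}"
proof -
  have "{y :: nat \<Rightarrow> real. \<forall>i<n. \<bar>y i - c i\<bar> < r} = (\<Inter>i\<in>{..<n}. {y. c i - r < y i} \<inter> {y. y i < c i + r})"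
    by (auto simp: abs_less_iff algebra_simps)
  moreover have "open (\<Inter>i\<in>{..<n}. {y :: nat \<Rightarrow> real. c i - r < y i} \<inter> {y. y i < c i + r})"
    by (intro open_INT ballI open_Int open_coordinate_gt open_coordinate_lt) simp
  ultimately show ?thesis by simp
qed

lemma open_N: "openin (top_of_set S) (N r)"
proof -
  have "N r = U \<inter> f -` {y. \<forall>i<n. \<bar>y i - c i\<bar> < r}" unfolding N_def by auto
  then have "openin (top_of_set U) (N r)" using continuous_openin_preimage_gen[OF cont_f open_box] by simp
  then show ?thesis using open_U by (rule openin_trans)
qed

lemma x_N: "x \<in> N \<delta>"
  using x \<delta> unfolding N_def c_def by simp

lemma compact_outside: "compact (S - N r)"
proof -
  obtain W where W: "open W" "N r = S \<inter> W" using open_N[of r] unfolding openin_open by blast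
  then have "S - N r = S \<inter> - W" by blast
  then show ?thesis using compact_Int_closed[OF S, of "- W"] W(1) by (simp add: closed_Compl)
qed

lemma outside_disjoint_D: "D (2 * \<delta>) \<inter> (S - N (3 * \<delta>)) = {}"
  using \<delta> unfolding D_def N_def by force

lemma boundary_zero: "z \<in> T \<Longrightarrow> z \<in> U \<Longrightarrow> f z (n - 1) = 0"
  using boundary_last_coordinate[OF n chart] by blast

lemma zero_boundary: "z \<in> U \<Longrightarrow> f z (n - 1) = 0 \<Longrightarrow> z \<in> T"
  using chart mem_manifold_boundary_iff by blast

lemma T_subset: "T \<subseteq> S"
  unfolding manifold_boundary_def by auto

text \<open>A point of the large box outside \<open>W\<close> differs from \<open>p\<close> by at
  least \<epsilon> in some coordinate and so falls into one of the slabs \<open>Kp k\<close>,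
  \<open>Km k\<close>. The strip of width 2 \<epsilon> between the slabs makes them
  disjoint.\<close>

lemma cover_exists:
  assumes "open W" "W \<inter> N \<delta> \<noteq> {}"
  obtains Kp Km where "\<And>k. compact (Kp k)" "\<And>k. compact (Km k)"
    "\<And>k. k < n \<Longrightarrow> Kp k \<subseteq> upper_part k" "\<And>k. k < n \<Longrightarrow> Km k \<subseteq> lower_part k"
    "\<And>k. Kp k \<inter> Km k = {}" "S \<subseteq> W \<union> (S - N (3 * \<delta>)) \<union> (\<Union>k<n. Kp k \<union> Km k)"
    "T \<subseteq> (S - N (3 * \<delta>)) \<union> Km (n - 1)"
proof -
  obtain z0 where z0: "z0 \<in> W" "z0 \<in> N \<delta>" using assms(2) by blast
  then have z0U: "z0 \<in> U" unfolding N_def by blast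
  have "openin (top_of_set S) (U \<inter> W)" using openin_Int_open[OF open_U assms(1)] .
  then have "openin (top_of_set U) (U \<inter> W)"
    using assms(1) openin_open_Int by blast
  then have "openin (top_of_set V) (f ` (U \<inter> W))" by (rule homeomorphism_imp_open_map[OF hom])
  then have "openin (top_of_set (half_fun n)) (f ` (U \<inter> W))" using open_V by (rule openin_trans)
  then obtain W' where W': "open W'" "f ` (U \<inter> W) = half_fun n \<inter> W'" unfolding openin_open by blast
  have o1: "open (W' \<inter> {y. \<forall>i<n. \<bar>y i - c i\<bar> < \<delta>})" using W'(1) open_box by (rule open_Int)
  have o2: "f z0 \<in> W' \<inter> {y. \<forall>i<n. \<bar>y i - c i\<bar> < \<delta>}"
    using W'(2) z0 z0U unfolding N_def by blast
  have fz0: "f z0 \<in> half_fun n" using f_V[OF z0U] VH by blast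
  then have fz0': "\<forall>i\<ge>n. f z0 i = 0" "0 \<le> f z0 (n - 1)" unfolding half_fun_def by simp_all
  obtain \<rho> where \<rho>: "0 < \<rho>"
    "box_fun n (\<lambda>i. f z0 i - \<rho>) (\<lambda>i. f z0 i + \<rho>) \<subseteq> W' \<inter> {y. \<forall>i<n. \<bar>y i - c i\<bar> < \<delta>}"
    using open_box_fun_nbhd[OF o1 o2 fz0'(1)] by blast
  text \<open>Moving up by \<open>\<rho> / 2\<close> in the last coordinate leads away from the boundary.\<close>
  define p where "p = (f z0)(n - 1 := f z0 (n - 1) + \<rho> / 2)"
  \<comment> \<open>Half of \<rho> serves twice: the \<epsilon>-box around \<open>p\<close> stays in
    the \<rho>-box around \<open>f z0\<close>, and the hyperplane lies at least \<epsilon> below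
    \<open>p\<close>, so the boundary falls into the lower slab.\<close>
  define \<epsilon> where "\<epsilon> = \<rho> / 2"
  have \<epsilon>: "0 < \<epsilon>" "\<epsilon> \<le> p (n - 1)" using \<rho>(1) fz0' unfolding \<epsilon>_def p_def by auto
  have p_near: "\<bar>p i - f z0 i\<bar> \<le> \<rho> / 2" for i using \<rho>(1) unfolding p_def by simp
  have pc: "\<bar>p k - c k\<bar> < \<delta>" if "k < n" for k
  proof -
    have "p \<in> box_fun n (\<lambda>i. f z0 i - \<rho>) (\<lambda>i. f z0 i + \<rho>)"
      using p_near fz0' \<rho>(1) n unfolding box_fun_def p_def by auto
    then show ?thesis using \<rho>(2) that by blast
  qed
  have inW: "z \<in> W" if z: "z \<in> U" "\<And>k. k < n \<Longrightarrow> \<bar>f z k - p k\<bar> < \<epsilon>" for z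
  proof -
    have fz: "f z \<in> half_fun n" using f_V[OF z(1)] VH by blast
    have "f z \<in> box_fun n (\<lambda>i. f z0 i - \<rho>) (\<lambda>i. f z0 i + \<rho>)"
    proof -
      have "f z0 i - \<rho> \<le> f z i \<and> f z i \<le> f z0 i + \<rho>" if "i < n" for i
        using z(2)[OF that] p_near[of i] unfolding \<epsilon>_def by (auto simp: abs_if split: if_splits)
      then show ?thesis using fz unfolding box_fun_def half_fun_def by blast
    qed
    then have "f z \<in> f ` (U \<inter> W)" using \<rho>(2) W'(2) fz by blast
    then obtain w where "w \<in> U \<inter> W" "f z = f w" by blast
    then have "z = w" using gf z(1) by (metis IntD1)
    then show ?thesis using \<open>w \<in> U \<inter> W\<close> by simp
  qed
  define Kp where "Kp k = {z \<in> D (3 * \<delta>). p k + \<epsilon> \<le> f z k}" for k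
  define Km where "Km k = {z \<in> D (3 * \<delta>). f z k \<le> p k - \<epsilon>}" for k
  have ND: "z \<in> D (3 * \<delta>)" if "z \<in> N (3 * \<delta>)" for z
    using that unfolding D_def N_def by force
  show ?thesis
  proof (rule that[of Kp Km])
    show "compact (Kp k)" "compact (Km k)" "Kp k \<inter> Km k = {}" for k
      unfolding Kp_def Km_def using \<epsilon>(1) by (auto intro!: compact_D_ge compact_D_le)
    show "Kp k \<subseteq> upper_part k" "Km k \<subseteq> lower_part k" if "k < n" for k
      using pc[OF that] \<epsilon>(1) unfolding Kp_def Km_def upper_part_def lower_part_def by (auto simp: abs_less_iff)
    show "T \<subseteq> (S - N (3 * \<delta>)) \<union> Km (n - 1)"
    proof
      fix z assume z: "z \<in> T"
      show "z \<in> (S - N (3 * \<delta>)) \<union> Km (n - 1)"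
      proof (cases "z \<in> N (3 * \<delta>)")
        case True
        then have "f z (n - 1) = 0" using boundary_zero[OF z] unfolding N_def by blast
        then show ?thesis using ND[OF True] \<epsilon>(2) unfolding Km_def by simp
      qed (use z T_subset in blast)
    qed
    show "S \<subseteq> W \<union> (S - N (3 * \<delta>)) \<union> (\<Union>k<n. Kp k \<union> Km k)"
    proof
      fix z assume z: "z \<in> S"
      show "z \<in> W \<union> (S - N (3 * \<delta>)) \<union> (\<Union>k<n. Kp k \<union> Km k)"
      proof (cases "z \<in> N (3 * \<delta>) \<and> z \<notin> W")
        case True
        then have "z \<in> U" unfolding N_def by blast
        then obtain k where k: "k < n" "\<not> \<bar>f z k - p k\<bar> < \<epsilon>" using inW True by blast
        then have "p k + \<epsilon> \<le> f z k \<or> f z k \<le> p k - \<epsilon>" by (auto simp: abs_if split: if_splits)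
        then have "z \<in> Kp k \<union> Km k" using ND True unfolding Kp_def Km_def by blast
        then show ?thesis using k(1) by blast
      qed (use z in blast)
    qed
  qed
qed

text \<open>An affine map followed by \<open>g\<close> takes the unit cube into
  \<open>D (2 * \<delta>)\<close>, and the preimages of the sets would contradict
  \<open>cube_not_covered\<close>. The delicate face is the bottom one in the last coordinate, which
  may land on the boundary instead of on \<open>lower_face\<close>.\<close>

lemma no_cover:
  assumes op: "\<And>k. k < n \<Longrightarrow> open (Ap k)" "\<And>k. k < n \<Longrightarrow> open (Am k)"
    and disj: "\<And>k. k < n \<Longrightarrow> Ap k \<inter> Am k = {}"
    and low: "\<And>k. k < n \<Longrightarrow> Ap k \<inter> lower_face k = {}" and up: "\<And>k. k < n \<Longrightarrow> Am k \<inter> upper_face k = {}"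
    and T: "T \<inter> D (2 * \<delta>) \<subseteq> Am (n - 1)"
  shows "\<not> D (2 * \<delta>) \<subseteq> (\<Union>k<n. Ap k \<union> Am k)"
proof
  assume cover: "D (2 * \<delta>) \<subseteq> (\<Union>k<n. Ap k \<union> Am k)"
  \<comment> \<open>In the last coordinate the box may stick out of the half-space; its bottom is
    then raised to 0. It stays below the top because \<open>c (n - 1)\<close> is
    nonnegative.\<close>
  define lo where "lo k = (if k = n - 1 then max 0 (c k - 2 * \<delta>) else c k - 2 * \<delta>)" for k
  define hi where "hi k = c k + 2 * \<delta>" for k
  define h where "h u = (\<lambda>k. if k < n then lo k + u k * (hi k - lo k) else 0)" for u :: "nat \<Rightarrow> real"
  define Q where "Q = box_fun n (\<lambda>_. 0) (\<lambda>_. 1)"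
  have "c \<in> half_fun n" unfolding c_def using f_V[OF x] VH by blast
  then have c0: "0 \<le> c (n - 1)" unfolding half_fun_def by blast
  then have lohi: "c k - 2 * \<delta> \<le> lo k" "lo k < hi k" for k
    using \<delta> unfolding lo_def hi_def by auto
  have h_box: "h u \<in> box_fun n (\<lambda>i. c i - 2 * \<delta>) (\<lambda>i. c i + 2 * \<delta>) \<inter> half_fun n" if u: "u \<in> Q" for u
  proof -
    have b: "lo k \<le> h u k \<and> h u k \<le> hi k" if "k < n" for k
    proof -
      have "0 \<le> u k" "u k \<le> 1" using u that unfolding Q_def box_fun_def by auto
      moreover have "0 \<le> hi k - lo k" using lohi(2)[of k] by simp
      ultimately have "0 \<le> u k * (hi k - lo k)" "u k * (hi k - lo k) \<le> 1 * (hi k - lo k)"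
        using mult_right_mono[of "u k" 1 "hi k - lo k"] by simp_all
      then show ?thesis using that unfolding h_def by simp
    qed
    have "0 \<le> h u (n - 1)" using b[of "n - 1"] n unfolding lo_def by auto
    moreover have "c k - 2 * \<delta> \<le> h u k \<and> h u k \<le> c k + 2 * \<delta>" if "k < n" for k
      using b[OF that] lohi(1)[of k] unfolding hi_def by linarith
    moreover have "h u i = 0" if "i \<ge> n" for i using that unfolding h_def by simp
    ultimately show ?thesis unfolding box_fun_def half_fun_def by blast
  qed
  have r: "2 * \<delta> \<le> 3 * \<delta>" using \<delta> by simp
  have hV: "h u \<in> V" if "u \<in> Q" for u using h_box[OF that] D_eq(2)[OF r] by blast
  have gh: "g (h u) \<in> D (2 * \<delta>)" if "u \<in> Q" for u
    using h_box[OF that] D_eq(1)[OF r, of UNIV] by auto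
  have "continuous_on UNIV h"
    unfolding h_def
  proof (rule continuous_on_coordinatewise_then_product)
    fix i show "continuous_on UNIV (\<lambda>u :: nat \<Rightarrow> real. if i < n then lo i + u i * (hi i - lo i) else 0)"
      by (cases "i < n") (auto intro!: continuous_intros)
  qed
  then have "continuous_on Q h" by (rule continuous_on_subset) simp
  then have cont: "continuous_on Q (\<lambda>u. g (h u))"
    by (rule continuous_on_compose2[OF cont_g]) (use hV in blast)
  define A where "A k = Q \<inter> (\<lambda>u. g (h u)) -` Ap k" for k
  define B where "B k = Q \<inter> (\<lambda>u. g (h u)) -` Am k" for k
  have fgh: "f (g (h u)) k = lo k + u k * (hi k - lo k)" if "u \<in> Q" "k < n" for u k
    using fg[OF hV[OF that(1)]] that(2) unfolding h_def by simp
  have "\<not> Q \<subseteq> (\<Union>k<n. A k \<union> B k)"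
    unfolding Q_def
  proof (rule cube_not_covered, fold Q_def)
    fix k assume k: "k < n"
    show "openin (top_of_set Q) (A k)" "openin (top_of_set Q) (B k)"
      unfolding A_def B_def using continuous_openin_preimage_gen[OF cont] op k by blast+
    show "A k \<inter> B k = {}" using disj[OF k] unfolding A_def B_def by blast
    fix u
    show "u k \<noteq> 1" if "u \<in> B k"
    proof
      assume "u k = 1"
      have u: "u \<in> Q" "g (h u) \<in> Am k" using that unfolding B_def by auto
      have "f (g (h u)) k = c k + 2 * \<delta>" using fgh[OF u(1) k] \<open>u k = 1\<close> unfolding hi_def by simp
      then show False using gh[OF u(1)] up[OF k] u(2) unfolding upper_face_def by blast
    qed
    show "u k \<noteq> 0" if "u \<in> A k"
    proof
      assume "u k = 0"
      have u: "u \<in> Q" "g (h u) \<in> Ap k" using that unfolding A_def by auto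
      have flo: "f (g (h u)) k = lo k" using fgh[OF u(1) k] \<open>u k = 0\<close> by simp
      have "lo k \<noteq> c k - 2 * \<delta>"
        using flo gh[OF u(1)] low[OF k] u(2) unfolding lower_face_def by auto
      \<comment> \<open>The bottom was raised, so the point lies on the boundary and hence in
        \<open>Am\<close>, which is disjoint from \<open>Ap\<close>.\<close>
      then have "k = n - 1" "lo k = 0" unfolding lo_def by (auto split: if_splits)
      then have "g (h u) \<in> T" using zero_boundary[OF g_U[OF hV[OF u(1)]]] flo by simp
      then have "g (h u) \<in> Am k" using T gh[OF u(1)] \<open>k = n - 1\<close> by blast
      then show False using disj[OF k] u(2) by blast
    qed
  qed
  moreover have "Q \<subseteq> (\<Union>k<n. A k \<union> B k)"
  proof
    fix u assume u: "u \<in> Q"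
    obtain k where "k < n" "g (h u) \<in> Ap k \<union> Am k" using subsetD[OF cover gh[OF u]] by blast
    then show "u \<in> (\<Union>k<n. A k \<union> B k)" using u unfolding A_def B_def by blast
  qed
  ultimately show False by blast
qed

end

section \<open>Local semidecidability\<close>

context effective_space
begin

text \<open>Replaces the demand that balls avoid \<open>F\<close>, which a search cannot test, by
  formal disjointness from finitely many fixed balls. Sufficiently fine covers of subsets of
  \<open>H\<close> automatically pass this test.\<close>

definition guard :: "'a set \<Rightarrow> 'a set \<Rightarrow> nat set \<Rightarrow> real \<Rightarrow> bool" where
  "guard F H W \<epsilon> \<longleftrightarrow> finite W \<and> 0 < \<epsilon> \<and> F \<subseteq> (\<Union>l\<in>W. I l) \<and>
     (\<forall>l\<in>W. \<forall>j. rad j < \<epsilon> \<longrightarrow> H \<inter> I j \<noteq> {} \<longrightarrow> formally_disjoint j l)"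

text \<open>The distance to \<open>B\<close> attains a positive minimum on \<open>A\<close>; a
  quarter of it suits \<open>formally_disjoint_small\<close>.\<close>

lemma compact_separated:
  assumes "compact A" "compact B" "A \<inter> B = {}"
  shows "\<exists>\<epsilon>>0. \<forall>x\<in>A. \<forall>y\<in>B. 4 * \<epsilon> \<le> dist x (y :: 'a)"
proof (cases "A = {} \<or> B = {}")
  case False
  then obtain a where a: "a \<in> A" "\<And>x. x \<in> A \<Longrightarrow> infdist a B \<le> infdist x B"
    using continuous_attains_inf[OF assms(1) _ continuous_on_infdist[OF continuous_on_id], of B] by auto
  have "infdist a B \<noteq> 0"
    using in_closed_iff_infdist_zero[OF compact_imp_closed[OF assms(2)]] a(1) assms(3) False by blast
  then have "0 < infdist a B" using infdist_nonneg[of a B] by simp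
  moreover have "infdist a B \<le> dist x y" if "x \<in> A" "y \<in> B" for x y
    using a(2)[OF that(1)] infdist_le[OF that(2), of x] by simp
  ultimately show ?thesis by (intro exI[of _ "infdist a B / 4"]) auto
qed (auto intro: exI[of _ 1])

lemma ex_guard:
  assumes "compact F" "compact H" "F \<inter> H = {}"
  shows "\<exists>W \<epsilon>. guard F H W \<epsilon>"
proof -
  obtain \<epsilon> where \<epsilon>: "0 < \<epsilon>" "\<And>x y. x \<in> F \<Longrightarrow> y \<in> H \<Longrightarrow> 4 * \<epsilon> \<le> dist x y"
    using compact_separated[OF assms] by blast
  obtain W where W: "finite W" "F \<subseteq> (\<Union>l\<in>W. I l)" "\<And>l. l \<in> W \<Longrightarrow> rad l < \<epsilon>" "\<And>l. l \<in> W \<Longrightarrow> F \<inter> I l \<noteq> {}"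
    using fine_cover[OF assms(1) \<epsilon>(1)] by blast
  have "formally_disjoint j l" if l: "l \<in> W" and j: "rad j < \<epsilon>" "H \<inter> I j \<noteq> {}" for l j
  proof -
    obtain x y where "x \<in> F" "x \<in> I l" "y \<in> H" "y \<in> I j" using W(4)[OF l] j(2) by blast
    then show ?thesis
      using formally_disjoint_small[OF j(1) W(3)[OF l], of y x] \<epsilon>(2)[of x y] by (simp add: dist_commute)
  qed
  then show ?thesis using W \<epsilon>(1) unfolding guard_def by blast
qed

text \<open>A ball of radius below \<epsilon> that meets \<open>Q\<close> has diameter at most 2
  \<epsilon> and cannot reach \<open>C\<close>.\<close>

lemma ex_cover_missing:
  assumes "compact Q" "compact C" "C \<inter> Q = {}"
  obtains P where "finite P" "Q \<subseteq> (\<Union>l\<in>P. I l)" "C \<inter> (\<Union>l\<in>P. I l) = {}"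
proof -
  obtain \<epsilon> where \<epsilon>: "0 < \<epsilon>" "\<And>x y. x \<in> C \<Longrightarrow> y \<in> Q \<Longrightarrow> 4 * \<epsilon> \<le> dist x y"
    using compact_separated[OF assms(2,1,3)] by blast
  obtain P where P: "finite P" "Q \<subseteq> (\<Union>l\<in>P. I l)" "\<And>l. l \<in> P \<Longrightarrow> rad l < \<epsilon>" "\<And>l. l \<in> P \<Longrightarrow> Q \<inter> I l \<noteq> {}"
    using fine_cover[OF assms(1) \<epsilon>(1)] by blast
  have "x \<notin> I l" if x: "x \<in> C" and l: "l \<in> P" for x l
  proof
    assume "x \<in> I l"
    obtain y where y: "y \<in> Q" "y \<in> I l" using P(4)[OF l] by blast
    have "dist x y \<le> dist (cen l) x + dist (cen l) y" by (rule dist_triangle3)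
    also have "\<dots> < 2 * \<epsilon>" using \<open>x \<in> I l\<close> y(2) P(3)[OF l] unfolding ballI_def by simp
    finally show False using \<epsilon>(2)[OF x y(1)] \<epsilon>(1) by simp
  qed
  then show ?thesis using P(1,2) by (intro that[of P]) auto
qed

text \<open>\<open>\<Omega> i\<close> searches for finite families of balls, coded by the entries \<open>2 * k\<close> and \<open>2 * k + 1\<close> of a
  sequence, which play the roles of \<open>Ap k\<close> and \<open>Am k\<close>; disjointness is replaced by the semidecidable
  formal disjointness.\<close>

lemma semidecidable_barrier:
  fixes S T C Q :: "'a set" and Fm Fp Hm Hp :: "nat \<Rightarrow> 'a set"
  assumes S: "usc S" and T: "usc T" and n: "n \<ge> 1" and C: "compact C" and Q: "compact Q" "C \<inter> Q = {}"
    and cpt: "\<And>k. compact (Fm k)" "\<And>k. compact (Fp k)" "\<And>k. compact (Hm k)" "\<And>k. compact (Hp k)"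
    and dis: "\<And>k. Fm k \<inter> Hp k = {}" "\<And>k. Fp k \<inter> Hm k = {}"
  obtains \<Omega> where "semidecidable \<Omega>"
    and "\<And>i Kp Km. (\<And>k. compact (Kp k)) \<Longrightarrow> (\<And>k. compact (Km k)) \<Longrightarrow>
      (\<And>k. k < n \<Longrightarrow> Kp k \<subseteq> Hp k) \<Longrightarrow> (\<And>k. k < n \<Longrightarrow> Km k \<subseteq> Hm k) \<Longrightarrow> (\<And>k. Kp k \<inter> Km k = {}) \<Longrightarrow>
      S \<subseteq> I i \<union> Q \<union> (\<Union>k<n. Kp k \<union> Km k) \<Longrightarrow> T \<subseteq> Q \<union> Km (n - 1) \<Longrightarrow> \<Omega> i"
    and "\<And>i. \<Omega> i \<Longrightarrow> \<exists>Ap Am. (\<forall>k<n. open (Ap k) \<and> open (Am k) \<and> Ap k \<inter> Am k = {} \<and>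
        Ap k \<inter> Fm k = {} \<and> Am k \<inter> Fp k = {}) \<and> S \<inter> C \<subseteq> I i \<union> (\<Union>k<n. Ap k \<union> Am k) \<and> T \<inter> C \<subseteq> Am (n - 1)"
proof -
  \<comment> \<open>\<open>P\<close> and the guards \<open>Wm k\<close>, \<open>Wp k\<close> are
    chosen without any effectivity; being finite, they can be fixed as constants of the
    search.\<close>
  obtain P where P: "finite P" "Q \<subseteq> (\<Union>l\<in>P. I l)" "C \<inter> (\<Union>l\<in>P. I l) = {}"
    by (rule ex_cover_missing[OF Q(1) C Q(2)])
  obtain Wm em where Wm: "\<And>k. guard (Fm k) (Hp k) (Wm k) (em k)"
    using ex_guard[OF cpt(1) cpt(4) dis(1)] by metis
  obtain Wp ep where Wp: "\<And>k. guard (Fp k) (Hm k) (Wp k) (ep k)"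
    using ex_guard[OF cpt(2) cpt(3) dis(2)] by metis
  let ?p = "\<lambda>e k. fin (\<sigma> e (2 * k))" and ?m = "\<lambda>e k. fin (\<sigma> e (Suc (2 * k)))"
  let ?M = "\<lambda>i e l. l = i \<or> (\<exists>b\<in>P. l = b) \<or> (\<exists>k\<in>{..<n}. l \<in> ?p e k \<or> l \<in> ?m e k)"
  \<comment> \<open>Only \<open>P\<close> and the last lower family may cover \<open>T\<close>; this
    is how the boundary comes to act as a lower face.\<close>
  let ?L = "\<lambda>e l. (\<exists>b\<in>P. l = b) \<or> l \<in> ?m e (n - 1)"
  define \<Omega> where "\<Omega> i \<longleftrightarrow> (\<exists>e. (\<forall>k\<in>{..<n}. (\<forall>a\<in>?p e k. \<forall>b\<in>?m e k. formally_disjoint a b) \<and>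
      (\<forall>a\<in>?p e k. \<forall>b\<in>Wm k. formally_disjoint a b) \<and> (\<forall>a\<in>?m e k. \<forall>b\<in>Wp k. formally_disjoint a b)) \<and>
      S \<subseteq> (\<Union>l\<in>Collect (?M i e). I l) \<and> T \<subseteq> (\<Union>l\<in>Collect (?L e). I l))" for i
  have fW: "finite (Wm k)" "finite (Wp k)" for k using Wm Wp unfolding guard_def by blast+
  show ?thesis
  proof (rule that[of \<Omega>])
    have "semidecidable (\<lambda>p. \<forall>k\<in>{..<n}. (\<forall>a\<in>?p (psnd p) k. \<forall>b\<in>?m (psnd p) k. formally_disjoint a b) \<and>
      (\<forall>a\<in>?p (psnd p) k. \<forall>b\<in>Wm k. formally_disjoint a b) \<and> (\<forall>a\<in>?m (psnd p) k. \<forall>b\<in>Wp k. formally_disjoint a b))"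
    proof (intro semidecidable_ball_finite[OF finite_lessThan] semidecidable_conj)
      fix k
      show "semidecidable (\<lambda>p. \<forall>a\<in>?p (psnd p) k. \<forall>b\<in>?m (psnd p) k. formally_disjoint a b)"
        by (intro semidecidable_fin_ball semidecidable_formally_disjoint computable_intros)
      show "semidecidable (\<lambda>p. \<forall>a\<in>?p (psnd p) k. \<forall>b\<in>Wm k. formally_disjoint a b)"
        "semidecidable (\<lambda>p. \<forall>a\<in>?m (psnd p) k. \<forall>b\<in>Wp k. formally_disjoint a b)"
        by (intro semidecidable_fin_ball semidecidable_ball_finite[OF fW(1)] semidecidable_ball_finite[OF fW(2)]
            semidecidable_formally_disjoint computable_intros)+
    qed
    moreover have inP: "semidecidable (\<lambda>p. \<exists>b\<in>P. psnd p = b)"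
      by (intro semidecidable_bex_finite[OF P(1)] semidecidable_decidable decidable_eq computable1_intros)
    have in_fin: "semidecidable (\<lambda>p. psnd p \<in> fin (\<sigma> (psnd (pfst p)) m))" for m
      by (intro semidecidable_decidable decidable_in_fin computable_\<sigma> computable1_psnd computable1_pfst
          computable1_id computable1_const)
    have "semidecidable (\<lambda>p. S \<subseteq> (\<Union>l\<in>Collect (?M (pfst p) (psnd p)). I l))"
    proof (rule semidecidable_cover[OF S], intro semidecidable_disj inP)
      show "semidecidable (\<lambda>p. psnd p = pfst (pfst p))"
        by (rule semidecidable_decidable[OF decidable_eq]) (intro computable1_intros)+
      show "semidecidable (\<lambda>p. \<exists>k\<in>{..<n}. psnd p \<in> ?p (psnd (pfst p)) k \<or> psnd p \<in> ?m (psnd (pfst p)) k)"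
        by (rule semidecidable_bex_finite[OF finite_lessThan]) (rule semidecidable_disj[OF in_fin in_fin])
    qed
    moreover have "semidecidable (\<lambda>p. T \<subseteq> (\<Union>l\<in>Collect (?L (psnd p)). I l))"
      by (rule semidecidable_cover[OF T]) (intro semidecidable_disj inP in_fin)
    ultimately show "semidecidable \<Omega>"
      unfolding \<Omega>_def by (intro semidecidable_ex semidecidable_conj)
  next
    fix i Kp Km
    assume K: "\<And>k. compact (Kp k)" "\<And>k. compact (Km k)"
      "\<And>k. k < n \<Longrightarrow> Kp k \<subseteq> Hp k" "\<And>k. k < n \<Longrightarrow> Km k \<subseteq> Hm k" "\<And>k. Kp k \<inter> Km k = {}"
      and SK: "S \<subseteq> I i \<union> Q \<union> (\<Union>k<n. Kp k \<union> Km k)" and TK: "T \<subseteq> Q \<union> Km (n - 1)"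
    have "\<exists>\<epsilon>>0. \<forall>x\<in>Kp k. \<forall>y\<in>Km k. 4 * \<epsilon> \<le> dist x y" for k
      by (rule compact_separated[OF K(1) K(2) K(5)])
    then obtain es where es: "\<And>k. 0 < es k" "\<And>k x y. x \<in> Kp k \<Longrightarrow> y \<in> Km k \<Longrightarrow> 4 * es k \<le> dist x y"
      by metis
    have e: "0 < em k" "0 < ep k" for k using Wm Wp unfolding guard_def by blast+
    \<comment> \<open>Radii below \<open>em k\<close> ensure formal disjointness from the guard,
      radii below \<open>es k\<close> from the balls covering \<open>Km k\<close>.\<close>
    have "\<exists>A. finite A \<and> Kp k \<subseteq> (\<Union>l\<in>A. I l) \<and> (\<forall>l\<in>A. rad l < min (em k) (es k) \<and> Kp k \<inter> I l \<noteq> {})" for k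
    proof -
      have "0 < min (em k) (es k)" using e es(1) by simp
      then show ?thesis by (rule fine_cover[OF K(1)])
    qed
    then obtain Bp where Bp: "\<And>k. finite (Bp k)" "\<And>k. Kp k \<subseteq> (\<Union>l\<in>Bp k. I l)"
      "\<And>k l. l \<in> Bp k \<Longrightarrow> rad l < min (em k) (es k) \<and> Kp k \<inter> I l \<noteq> {}" by metis
    have "\<exists>A. finite A \<and> Km k \<subseteq> (\<Union>l\<in>A. I l) \<and> (\<forall>l\<in>A. rad l < min (ep k) (es k) \<and> Km k \<inter> I l \<noteq> {})" for k
    proof -
      have "0 < min (ep k) (es k)" using e es(1) by simp
      then show ?thesis by (rule fine_cover[OF K(2)])
    qed
    then obtain Bm where Bm: "\<And>k. finite (Bm k)" "\<And>k. Km k \<subseteq> (\<Union>l\<in>Bm k. I l)"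
      "\<And>k l. l \<in> Bm k \<Longrightarrow> rad l < min (ep k) (es k) \<and> Km k \<inter> I l \<noteq> {}" by metis
    have "finite (if even m then Bp (m div 2) else Bm (m div 2))" for m using Bp(1) Bm(1) by simp
    then obtain e where e: "\<forall>m<2 * n. fin (\<sigma> e m) = (if even m then Bp (m div 2) else Bm (m div 2))"
      using fin_family_surj[of "2 * n" "\<lambda>m. if even m then Bp (m div 2) else Bm (m div 2)"] n by auto
    have pm: "?p e k = Bp k" "?m e k = Bm k" if "k < n" for k
      using e[rule_format, of "2 * k"] e[rule_format, of "Suc (2 * k)"] that by auto
    show "\<Omega> i"
      unfolding \<Omega>_def
    proof (intro exI[of _ e] conjI ballI)
      fix k a b assume "k \<in> {..<n}"
      then have k: "k < n" by simp
      show "formally_disjoint a b" if "a \<in> ?p e k" "b \<in> ?m e k"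
      proof -
        have ab: "a \<in> Bp k" "b \<in> Bm k" using that pm[OF k] by simp_all
        obtain x y where "x \<in> Kp k" "x \<in> I a" "y \<in> Km k" "y \<in> I b" using Bp(3)[OF ab(1)] Bm(3)[OF ab(2)] by blast
        then show ?thesis
          using formally_disjoint_small[of a "es k" b x y] es(2)[of x k y] Bp(3)[OF ab(1)] Bm(3)[OF ab(2)] by simp
      qed
      show "formally_disjoint a b" if "a \<in> ?p e k" "b \<in> Wm k"
      proof -
        have a: "rad a < em k" "Kp k \<inter> I a \<noteq> {}" using Bp(3)[of a k] that(1) pm[OF k] by simp_all
        then have "Hp k \<inter> I a \<noteq> {}" using K(3)[OF k] by blast
        then show ?thesis using Wm[of k] a(1) that(2) unfolding guard_def by blast
      qed
      show "formally_disjoint a b" if "a \<in> ?m e k" "b \<in> Wp k"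
      proof -
        have a: "rad a < ep k" "Km k \<inter> I a \<noteq> {}" using Bm(3)[of a k] that(1) pm[OF k] by simp_all
        then have "Hm k \<inter> I a \<noteq> {}" using K(4)[OF k] by blast
        then show ?thesis using Wp[of k] a(1) that(2) unfolding guard_def by blast
      qed
    next
      show "S \<subseteq> (\<Union>l\<in>Collect (?M i e). I l)"
      proof
        fix z assume "z \<in> S"
        then consider "z \<in> I i" | "z \<in> Q" | k where "k < n" "z \<in> Kp k \<union> Km k" using SK by blast
        then show "z \<in> (\<Union>l\<in>Collect (?M i e). I l)"
        proof cases
          case 2 then show ?thesis using P(2) by blast
        next
          case (3 k)
          then obtain l where "l \<in> Bp k \<union> Bm k" "z \<in> I l" using Bp(2)[of k] Bm(2)[of k] by blast
          then show ?thesis using pm[OF 3(1)] 3(1) by blast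
        qed blast
      qed
      have m: "?m e (n - 1) = Bm (n - 1)" using pm(2)[of "n - 1"] n by simp
      show "T \<subseteq> (\<Union>l\<in>Collect (?L e). I l)"
      proof
        fix z assume "z \<in> T"
        then consider "z \<in> Q" | "z \<in> Km (n - 1)" using TK by blast
        then obtain l where "l \<in> P \<or> l \<in> Bm (n - 1)" "z \<in> I l"
          using P(2) Bm(2)[of "n - 1"] by cases blast+
        then show "z \<in> (\<Union>l\<in>Collect (?L e). I l)" using m by (intro UN_I[of l]) auto
      qed
    qed
  next
    fix i assume "\<Omega> i"
    then obtain e where F: "\<forall>k\<in>{..<n}. (\<forall>a\<in>?p e k. \<forall>b\<in>?m e k. formally_disjoint a b) \<and>
      (\<forall>a\<in>?p e k. \<forall>b\<in>Wm k. formally_disjoint a b) \<and> (\<forall>a\<in>?m e k. \<forall>b\<in>Wp k. formally_disjoint a b)"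
      and Sc: "S \<subseteq> (\<Union>l\<in>Collect (?M i e). I l)" and Tc: "T \<subseteq> (\<Union>l\<in>Collect (?L e). I l)"
      unfolding \<Omega>_def by (elim exE conjE)
    have fd: "a \<in> ?p e k \<Longrightarrow> b \<in> ?m e k \<Longrightarrow> formally_disjoint a b"
      and fm: "a \<in> ?p e k \<Longrightarrow> b \<in> Wm k \<Longrightarrow> formally_disjoint a b"
      and fp: "a \<in> ?m e k \<Longrightarrow> b \<in> Wp k \<Longrightarrow> formally_disjoint a b" if "k < n" for k a b
      using F that by blast+
    let ?Ap = "\<lambda>k. \<Union>l\<in>?p e k. I l" and ?Am = "\<lambda>k. \<Union>l\<in>?m e k. I l"
    have dj: "(\<Union>l\<in>A. I l) \<inter> (\<Union>l\<in>B. I l) = {}" if "\<And>a b. a \<in> A \<Longrightarrow> b \<in> B \<Longrightarrow> formally_disjoint a b" for A B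
      using that formally_disjoint_imp_disjoint by blast
    have "?Ap k \<inter> ?Am k = {}" "?Ap k \<inter> Fm k = {}" "?Am k \<inter> Fp k = {}" if "k < n" for k
    proof -
      show "?Ap k \<inter> ?Am k = {}" by (rule dj) (rule fd[OF that])
      have "?Ap k \<inter> (\<Union>l\<in>Wm k. I l) = {}" by (rule dj) (rule fm[OF that])
      then show "?Ap k \<inter> Fm k = {}" using Wm[of k] unfolding guard_def by blast
      have "?Am k \<inter> (\<Union>l\<in>Wp k. I l) = {}" by (rule dj) (rule fp[OF that])
      then show "?Am k \<inter> Fp k = {}" using Wp[of k] unfolding guard_def by blast
    qed
    moreover have "open (?Ap k)" "open (?Am k)" for k by (intro open_UN ballI open_I)+
    moreover have "S \<inter> C \<subseteq> I i \<union> (\<Union>k<n. ?Ap k \<union> ?Am k)"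
    proof
      fix z assume z: "z \<in> S \<inter> C"
      then obtain l where l: "?M i e l" "z \<in> I l" using Sc by blast
      \<comment> \<open>Balls of \<open>P\<close> do not reach \<open>C\<close>, so there the cover
        consists of \<open>I i\<close> and the searched families alone.\<close>
      moreover have "l \<notin> P" using z l(2) P(3) by blast
      ultimately show "z \<in> I i \<union> (\<Union>k<n. ?Ap k \<union> ?Am k)" by blast
    qed
    moreover have "T \<inter> C \<subseteq> ?Am (n - 1)"
    proof
      fix z assume z: "z \<in> T \<inter> C"
      then obtain l where l: "?L e l" "z \<in> I l" using Tc by blast
      moreover have "l \<notin> P" using z l(2) P(3) by blast
      ultimately show "z \<in> ?Am (n - 1)" by blast
    qed
    ultimately show "\<exists>Ap Am. (\<forall>k<n. open (Ap k) \<and> open (Am k) \<and> Ap k \<inter> Am k = {} \<and>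
        Ap k \<inter> Fm k = {} \<and> Am k \<inter> Fp k = {}) \<and> S \<inter> C \<subseteq> I i \<union> (\<Union>k<n. Ap k \<union> Am k) \<and> T \<inter> C \<subseteq> Am (n - 1)"
      by (intro exI[of _ ?Ap] exI[of _ ?Am] conjI allI impI)
  qed
qed

text \<open>\<open>\<Omega>\<close> must accept the balls that meet \<open>N\<close> and may accept
  any other ball that meets \<open>S\<close>. This slack is harmless: over a cover of
  \<open>S\<close> the disjunction of such predicates is exact.\<close>

lemma locally_semidecidable:
  assumes "n \<ge> 1" "usc S" "usc (manifold_boundary n (top_of_set S))"
    and chart: "chart S n U V f g" "x \<in> U"
  shows "\<exists>N \<Omega>. openin (top_of_set S) N \<and> x \<in> N \<and> semidecidable \<Omega> \<and>
     (\<forall>i. N \<inter> I i \<noteq> {} \<longrightarrow> \<Omega> i) \<and> (\<forall>i. \<Omega> i \<longrightarrow> S \<inter> I i \<noteq> {})"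
proof -
  obtain \<delta> where \<delta>: "0 < \<delta>" "box_fun n (\<lambda>i. f x i - 3 * \<delta>) (\<lambda>i. f x i + 3 * \<delta>) \<inter> half_fun n \<subseteq> V"
    by (rule ex_chart_box[OF chart])
  interpret chart_box S n U V f g x \<delta>
    using assms \<delta> unfolding usc_def by unfold_locales auto
  have r: "2 * \<delta> \<le> 3 * \<delta>" using \<delta> by simp
  show ?thesis
  proof (rule semidecidable_barrier[OF assms(2,3,1) compact_D[OF r] compact_outside outside_disjoint_D
        compact_parts(1,2,3,4) disjoint_parts])
    fix \<Omega> assume sd: "semidecidable \<Omega>"
      and complete: "\<And>i Kp Km. (\<And>k. compact (Kp k)) \<Longrightarrow> (\<And>k. compact (Km k)) \<Longrightarrow>
        (\<And>k. k < n \<Longrightarrow> Kp k \<subseteq> upper_part k) \<Longrightarrow> (\<And>k. k < n \<Longrightarrow> Km k \<subseteq> lower_part k) \<Longrightarrow> (\<And>k. Kp k \<inter> Km k = {}) \<Longrightarrow>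
        S \<subseteq> I i \<union> (S - N (3 * \<delta>)) \<union> (\<Union>k<n. Kp k \<union> Km k) \<Longrightarrow> T \<subseteq> (S - N (3 * \<delta>)) \<union> Km (n - 1) \<Longrightarrow> \<Omega> i"
      and sound: "\<And>i. \<Omega> i \<Longrightarrow> \<exists>Ap Am. (\<forall>k<n. open (Ap k) \<and> open (Am k) \<and> Ap k \<inter> Am k = {} \<and>
          Ap k \<inter> lower_face k = {} \<and> Am k \<inter> upper_face k = {}) \<and>
          S \<inter> D (2 * \<delta>) \<subseteq> I i \<union> (\<Union>k<n. Ap k \<union> Am k) \<and> T \<inter> D (2 * \<delta>) \<subseteq> Am (n - 1)"
    have "\<Omega> i" if ne: "N \<delta> \<inter> I i \<noteq> {}" for i
    proof -
      have "I i \<inter> N \<delta> \<noteq> {}" using ne by blast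
      then show ?thesis by (rule cover_exists[OF open_I]) (rule complete)
    qed
    moreover have "S \<inter> I i \<noteq> {}" if \<Omega>i: "\<Omega> i" for i
    proof
      assume e: "S \<inter> I i = {}"
      obtain Ap Am where A: "\<forall>k<n. open (Ap k) \<and> open (Am k) \<and> Ap k \<inter> Am k = {} \<and>
          Ap k \<inter> lower_face k = {} \<and> Am k \<inter> upper_face k = {}"
        and c: "S \<inter> D (2 * \<delta>) \<subseteq> I i \<union> (\<Union>k<n. Ap k \<union> Am k)" and t: "T \<inter> D (2 * \<delta>) \<subseteq> Am (n - 1)"
        using sound[OF \<Omega>i] by blast
      have "D (2 * \<delta>) \<subseteq> S" using US unfolding D_def by blast
      then have "D (2 * \<delta>) \<subseteq> (\<Union>k<n. Ap k \<union> Am k)" using c e by blast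
      moreover have "\<not> D (2 * \<delta>) \<subseteq> (\<Union>k<n. Ap k \<union> Am k)" by (rule no_cover) (use A t in blast)+
      ultimately show False by blast
    qed
    ultimately show ?thesis using open_N[of \<delta>] x_N sd by (intro exI[of _ "N \<delta>"] exI[of _ \<Omega>] conjI allI impI)
  qed
qed

end

section \<open>Gluing finitely many local searches\<close>

theorem theorem6p4:
  fixes \<alpha> :: "nat \<Rightarrow> 'a::metric_space" and S :: "'a set" and n :: nat
    and q :: "nat \<Rightarrow> rat" and \<tau>1 \<tau>2 :: "nat \<Rightarrow> nat"
    and \<sigma> :: "nat \<Rightarrow> nat \<Rightarrow> nat" and \<eta> :: "nat \<Rightarrow> nat"
  assumes "enum_data q \<tau>1 \<tau>2 \<sigma> \<eta>"
    and "computable_metric_space \<alpha>"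
    and "locally_computable \<alpha> q \<tau>1 \<tau>2 \<sigma> \<eta>"
    and "coce_closed \<alpha> q \<tau>1 \<tau>2 S"
    and "compact S"
    and "manifold_with_boundary n (top_of_set S)"
    and "computable_closed \<alpha> q \<tau>1 \<tau>2 (manifold_boundary n (top_of_set S))"
  shows "computable_closed \<alpha> q \<tau>1 \<tau>2 S"
proof -
  interpret effective_space \<alpha> q \<tau>1 \<tau>2 \<sigma> \<eta> using assms(1,2) by unfold_locales
  obtain L where L: "S \<subseteq> L" "computable_compact \<alpha> q \<tau>1 \<tau>2 \<sigma> \<eta> L"
    using assms(3,5) unfolding locally_computable_def by blast
  have S: "usc S" by (rule usc_coce_closed[OF L(2) assms(4) L(1)])
  have "manifold_boundary n (top_of_set S) \<subseteq> L" using L(1) unfolding manifold_boundary_def by auto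
  then have T: "usc (manifold_boundary n (top_of_set S))"
    using usc_coce_closed[OF L(2)] assms(7) unfolding computable_closed_def by blast
  have n: "n \<ge> 1" using assms(6) unfolding manifold_with_boundary_def by blast
  \<comment> \<open>Neighbourhood and predicate are bundled into a pair so that one application of
    choice selects both. The neighbourhood is extended to an open set of the whole space for use
    with compactness.\<close>
  have "\<forall>x\<in>S. \<exists>w. open (fst w) \<and> x \<in> fst w \<and> semidecidable (snd w) \<and>
     (\<forall>i. S \<inter> fst w \<inter> I i \<noteq> {} \<longrightarrow> snd w i) \<and> (\<forall>i. snd w i \<longrightarrow> S \<inter> I i \<noteq> {})"
  proof
    fix x assume x: "x \<in> S"
    obtain U V f g where "chart S n U V f g" "x \<in> U" by (rule manifold_with_boundary_chart[OF assms(6) x])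
    from locally_semidecidable[OF n S T this]
    obtain N \<Omega> where N: "openin (top_of_set S) N" "x \<in> N" and \<Omega>: "semidecidable \<Omega>"
      "\<forall>i. N \<inter> I i \<noteq> {} \<longrightarrow> \<Omega> i" "\<forall>i. \<Omega> i \<longrightarrow> S \<inter> I i \<noteq> {}"
      by (elim exE conjE)
    obtain W where "open W" "N = S \<inter> W" using N(1) unfolding openin_open by blast
    then show "\<exists>w. open (fst w) \<and> x \<in> fst w \<and> semidecidable (snd w) \<and>
     (\<forall>i. S \<inter> fst w \<inter> I i \<noteq> {} \<longrightarrow> snd w i) \<and> (\<forall>i. snd w i \<longrightarrow> S \<inter> I i \<noteq> {})"
      using N(2) \<Omega> by (intro exI[of _ "(W, \<Omega>)"]) auto
  qed
  from bchoice[OF this] obtain w where w: "\<forall>x\<in>S. open (fst (w x)) \<and> x \<in> fst (w x) \<and> semidecidable (snd (w x)) \<and>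
     (\<forall>i. S \<inter> fst (w x) \<inter> I i \<noteq> {} \<longrightarrow> snd (w x) i) \<and> (\<forall>i. snd (w x) i \<longrightarrow> S \<inter> I i \<noteq> {})" ..
  define W \<Omega> where "W x = fst (w x)" and "\<Omega> x = snd (w x)" for x
  have W: "open (W x)" "x \<in> W x" and \<Omega>: "semidecidable (\<Omega> x)" "S \<inter> W x \<inter> I i \<noteq> {} \<Longrightarrow> \<Omega> x i"
    "\<Omega> x i \<Longrightarrow> S \<inter> I i \<noteq> {}" if "x \<in> S" for x i
    using bspec[OF w that] unfolding W_def \<Omega>_def by blast+
  have "S \<subseteq> (\<Union>x\<in>S. W x)" using W(2) by blast
  then obtain X where X: "X \<subseteq> S" "finite X" "S \<subseteq> (\<Union>x\<in>X. W x)"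
    using compactE_image[OF assms(5), of S W] W(1) by metis
  have "S \<inter> I i \<noteq> {} \<longleftrightarrow> (\<exists>x\<in>X. \<Omega> x i)" for i
  proof
    assume "S \<inter> I i \<noteq> {}"
    then obtain z where z: "z \<in> S" "z \<in> I i" by blast
    then obtain x where "x \<in> X" "z \<in> W x" using X(3) by blast
    then show "\<exists>x\<in>X. \<Omega> x i" using z X(1) \<Omega>(2)[of x i] by blast
  next
    assume "\<exists>x\<in>X. \<Omega> x i"
    then show "S \<inter> I i \<noteq> {}" using \<Omega>(3) X(1) by blast
  qed
  moreover have "semidecidable (\<lambda>i. \<exists>x\<in>X. \<Omega> x i)"
    by (rule semidecidable_bex_finite[OF X(2)]) (use \<Omega>(1) X(1) in blast)
  ultimately have "ce_set {i. S \<inter> I i \<noteq> {}}" by (simp add: ce_set_iff_semidecidable)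
  then show ?thesis
    using assms(4) unfolding computable_closed_def ce_closed_def coce_closed_def by blast
qed

end
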